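(* Let $\Xi=(G,L,K)$ be a scattering passive boundary node on Hilbert spaces $(\mathcal U,\mathcal X,\mathcal Y)$ with solution space $\mathcal Z$, and let $\mathcal X_1=\ker(G)$ be equipped with the norm $\|z\|_{\mathcal X_1}=\|(1-L)z\|_{\mathcal X}$. Let $H$ be a dissipative operator on $\mathcal X$ with $\mathcal Z\subset\mathrm{dom}(H)$, meaning that $H:\mathrm{dom}(H)\subset\mathcal X\to\mathcal X$ is a linear operator satisfying $\mathcal Z\subset\mathrm{dom}(H)$ and $\mathrm{Re}\,\langle z,Hz\rangle_{\mathcal X}\le 0$ for all $z\in\mathcal Z$. Consider the two assumptions: (i) There are $a>0$ and $0\le b<1$ such that $\|Hz\|_{\mathcal X}\le a\|z\|_{\mathcal X}+b\|Lz\|_{\mathcal X}$ for all $z\in\ker(G)$. (ii) There is a Hilbert space $\tilde{\mathcal X}$ such that $\mathcal X_1\subset\tilde{\mathcal X}\subset\mathrm{dom}(H)$, the inclusion $\mathcal X_1\subset\tilde{\mathcal X}$ is compact, and $H|_{\tilde{\mathcal X}}$ is a bounded linear operator from $\tilde{\mathcal X}$ into $\mathcal X$. If either (i) or (ii) holds, then $\Xi_H:=(G,L+H,K)$ (with domain $\mathcal Z$) is a scattering passive boundary node, and $\mathrm{dom}(A)=\mathrm{dom}(A_H)$, where $A=L|_{\ker(G)}$ and $A_H=(L+H)|_{\ker(G)}$ are the semigroup generators of $\Xi$ and $\Xi_H$, respectively. If (in addition) the node $\Xi$ is strong and $H$ is a bounded operator on $\mathcal X$, then $\Xi_H$ is a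 strong boundary node as well.
   Context: $\mathbb R^+=[0,\infty)$, and all Hilbert spaces are complex. Internally well-posed boundary node: a triple $\Xi=(G,L,K)$ of linear operators with the same domain $\mathcal Z\subset\mathcal X$ (the solution space) and with values in the Hilbert spaces $\mathcal U$, $\mathcal X$, $\mathcal Y$, respectively, is an internally well-posed boundary node on $(\mathcal U,\mathcal X,\mathcal Y)$ if (1) $\begin{bmatrix}G\\ L\\ K\end{bmatrix}$ is a closed operator from $\mathcal X$ into $\mathcal U\times\mathcal X\times\mathcal Y$ with domain $\mathcal Z$; (2) $G$ is surjective and $\ker(G)$ is dense in $\mathcal X$; (3) $L|_{\ker(G)}$, as an unbounded operator in $\mathcal X$ with domain $\ker(G)$, generates a strongly continuous semigroup on $\mathcal X$. The operator $L|_{\ker(G)}$ is called the semigroup generator. The node is strong if, in addition, $L$ is a closed operator on $\mathcal X$ with domain $\mathcal Z$. The space $\mathcal Z$ is a Hilbert space with the graph norm $\|z\|_{\mathcal Z}^2=\|z\|_{\mathcal X}^2+\|Lz\|_{\mathcal X}^2+\|Gz\|_{\mathcal U}^2+\|Kz\|_{\mathcal Y}^2$. For such a node, for all $z_0\in\mathcal Z$ and $u\in C^2(\mathbb R^+;\mathcal U)$ with $Gz_0=u(0)$, the equations $u(t)=Gz(t)$, $\dot z(t)=Lz(t)$, $z(0)=z_0$ have a unique (``smooth'') solution $z\in C^1(\mathbb R^+;\mathcal X)\cap C(\mathbb R^+;\mathcal Z)$; set $y(t)=Kz(t)$. A scattering passive boundary node is an internally well-posed boundary node such that all smooth solutions satisfy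 $\frac{d}{dt}\|z(t)\|_{\mathcal X}^2+\|y(t)\|_{\mathcal Y}^2\le\|u(t)\|_{\mathcal U}^2$ for all $t\in\mathbb R^+$. *)

theory Defs
  imports "HOL-Analysis.Analysis"
begin

section \<open>Complex Hilbert spaces\<close>

text \<open>
  The inner product is conjugate linear in the first and linear in the second argument.
  The inherited real structure is tied to the complex one by \<open>scaleR_scaleC\<close> and
  \<open>inner_eq_Re_cinner\<close>; in particular \<open>norm\<close> is the norm induced by \<open>cinner\<close>.
\<close>

class complex_hilbert = real_inner + complete_space +
  fixes scaleC :: "complex \<Rightarrow> 'a \<Rightarrow> 'a"  (infixr "*\<^sub>C" 75)
    and cinner :: "'a \<Rightarrow> 'a \<Rightarrow> complex"
  assumes scaleC_add_right: "c *\<^sub>C (x + y) = c *\<^sub>C x + c *\<^sub>C y"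
    and scaleC_add_left: "(c + d) *\<^sub>C x = c *\<^sub>C x + d *\<^sub>C x"
    and scaleC_scaleC: "c *\<^sub>C d *\<^sub>C x = (c * d) *\<^sub>C x"
    and scaleR_scaleC: "r *\<^sub>R x = complex_of_real r *\<^sub>C x"
    and cinner_commute: "cinner x y = cnj (cinner y x)"
    and cinner_add_right: "cinner x (y + z) = cinner x y + cinner x z"
    and cinner_scaleC_right: "cinner x (c *\<^sub>C y) = c * cinner x y"
    and inner_eq_Re_cinner: "inner x y = Re (cinner x y)"
begin

subclass banach ..

end

instantiation complex :: complex_hilbert
begin

definition scaleC_complex :: "complex \<Rightarrow> complex \<Rightarrow> complex"
  where "scaleC_complex c x = c * x"

definition cinner_complex :: "complex \<Rightarrow> complex \<Rightarrow> complex"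
  where "cinner_complex x y = cnj x * y"

instance
  by standard
    (auto simp: scaleC_complex_def cinner_complex_def algebra_simps scaleR_conv_of_real
      inner_complex_def)

end

section \<open>Unbounded operators\<close>

definition csubspace :: "'a::complex_hilbert set \<Rightarrow> bool"
  where "csubspace S \<longleftrightarrow>
    0 \<in> S \<and> (\<forall>x\<in>S. \<forall>y\<in>S. x + y \<in> S) \<and> (\<forall>c. \<forall>x\<in>S. c *\<^sub>C x \<in> S)"

definition clinear_on :: "'a::complex_hilbert set \<Rightarrow> ('a \<Rightarrow> 'b::complex_hilbert) \<Rightarrow> bool"
  where "clinear_on S f \<longleftrightarrow> csubspace S \<and>
    (\<forall>x\<in>S. \<forall>y\<in>S. f (x + y) = f x + f y) \<and> (\<forall>c. \<forall>x\<in>S. f (c *\<^sub>C x) = c *\<^sub>C f x)"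

definition bounded_clinear :: "('a::complex_hilbert \<Rightarrow> 'b::complex_hilbert) \<Rightarrow> bool"
  where "bounded_clinear f \<longleftrightarrow> clinear_on UNIV f \<and> (\<exists>C. \<forall>x. norm (f x) \<le> C * norm x)"

text \<open>
  An unbounded operator is a domain together with a total function, of which only the
  values on the domain are meaningful.
\<close>

type_synonym ('a, 'b) unbounded_op = "'a set \<times> ('a \<Rightarrow> 'b)"

definition op_dom :: "('a, 'b) unbounded_op \<Rightarrow> 'a set"
  where "op_dom T = fst T"

definition op_fun :: "('a, 'b) unbounded_op \<Rightarrow> 'a \<Rightarrow> 'b"
  where "op_fun T = snd T"

definition closed_op :: "('a::topological_space, 'b::topological_space) unbounded_op \<Rightarrow> bool"
  where "closed_op T \<longleftrightarrow> closed {(x, op_fun T x) | x. x \<in> op_dom T}"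

section \<open>Strongly continuous semigroups\<close>

text \<open>Only the values \<open>T t\<close> with \<open>t \<ge> 0\<close> are meaningful.\<close>

definition C0_semigroup :: "(real \<Rightarrow> 'a::complex_hilbert \<Rightarrow> 'a) \<Rightarrow> bool"
  where "C0_semigroup T \<longleftrightarrow>
    (\<forall>t\<ge>0. bounded_clinear (T t)) \<and>
    (\<forall>x. T 0 x = x) \<and>
    (\<forall>s\<ge>0. \<forall>t\<ge>0. \<forall>x. T (s + t) x = T s (T t x)) \<and>
    (\<forall>x. ((\<lambda>t. T t x) \<longlongrightarrow> x) (at_right 0))"

definition generates_C0_semigroup :: "('a::complex_hilbert, 'a) unbounded_op \<Rightarrow> bool"
  where "generates_C0_semigroup A \<longleftrightarrow> (\<exists>T. C0_semigroup T \<and>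
    op_dom A = {x. \<exists>y. ((\<lambda>h. (1 / h) *\<^sub>R (T h x - x)) \<longlongrightarrow> y) (at_right 0)} \<and>
    (\<forall>x\<in>op_dom A. ((\<lambda>h. (1 / h) *\<^sub>R (T h x - x)) \<longlongrightarrow> op_fun A x) (at_right 0)))"

section \<open>Boundary nodes\<close>

text \<open>
  A node \<open>\<Xi> = (G, L, K)\<close> is passed as its solution space \<open>Z\<close> and the three operators
  with common domain \<open>Z\<close>.
\<close>

definition node_ker :: "'x set \<Rightarrow> ('x \<Rightarrow> 'u::complex_hilbert) \<Rightarrow> 'x set"
  where "node_ker Z G = {z \<in> Z. G z = 0}"

definition semigroup_generator ::
    "'x set \<Rightarrow> ('x \<Rightarrow> 'u::complex_hilbert) \<Rightarrow> ('x \<Rightarrow> 'x) \<Rightarrow> ('x, 'x) unbounded_op"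
  where "semigroup_generator Z G L = (node_ker Z G, L)"

definition internally_wellposed_node ::
    "'x::complex_hilbert set \<Rightarrow> ('x \<Rightarrow> 'u::complex_hilbert) \<Rightarrow> ('x \<Rightarrow> 'x)
      \<Rightarrow> ('x \<Rightarrow> 'y::complex_hilbert) \<Rightarrow> bool"
  where "internally_wellposed_node Z G L K \<longleftrightarrow>
    clinear_on Z G \<and> clinear_on Z L \<and> clinear_on Z K \<and>
    closed_op (Z, \<lambda>z. (G z, L z, K z)) \<and>
    G ` Z = UNIV \<and> closure (node_ker Z G) = UNIV \<and>
    generates_C0_semigroup (semigroup_generator Z G L)"

definition strong_node ::
    "'x::complex_hilbert set \<Rightarrow> ('x \<Rightarrow> 'u::complex_hilbert) \<Rightarrow> ('x \<Rightarrow> 'x)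
      \<Rightarrow> ('x \<Rightarrow> 'y::complex_hilbert) \<Rightarrow> bool"
  where "strong_node Z G L K \<longleftrightarrow> internally_wellposed_node Z G L K \<and> closed_op (Z, L)"

definition graph_norm ::
    "('x::complex_hilbert \<Rightarrow> 'u::complex_hilbert) \<Rightarrow> ('x \<Rightarrow> 'x)
      \<Rightarrow> ('x \<Rightarrow> 'y::complex_hilbert) \<Rightarrow> 'x \<Rightarrow> real"
  where "graph_norm G L K z =
    sqrt ((norm z)\<^sup>2 + (norm (L z))\<^sup>2 + (norm (G z))\<^sup>2 + (norm (K z))\<^sup>2)"

text \<open>Derivatives on \<open>[0, \<infinity>)\<close> are one-sided at \<open>0\<close>.\<close>

definition C2_halfline :: "(real \<Rightarrow> 'a::real_normed_vector) \<Rightarrow> bool"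
  where "C2_halfline u \<longleftrightarrow> (\<exists>u' u''.
    (\<forall>t\<ge>0. (u has_vector_derivative u' t) (at t within {0..})) \<and>
    (\<forall>t\<ge>0. (u' has_vector_derivative u'' t) (at t within {0..})) \<and>
    continuous_on {0..} u'')"

text \<open>
  The derivative of \<open>z\<close> is \<open>L z\<close>, so the continuity of \<open>\<lambda>t. L (z t)\<close> says that \<open>z\<close> is
  of class \<open>C\<^sup>1\<close>; the limit in the graph norm says that \<open>z\<close> is continuous with
  values in \<open>Z\<close>.
\<close>

definition smooth_solution ::
    "'x::complex_hilbert set \<Rightarrow> ('x \<Rightarrow> 'u::complex_hilbert) \<Rightarrow> ('x \<Rightarrow> 'x)
      \<Rightarrow> ('x \<Rightarrow> 'y::complex_hilbert) \<Rightarrow> (real \<Rightarrow> 'u) \<Rightarrow> (real \<Rightarrow> 'x) \<Rightarrow> bool"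
  where "smooth_solution Z G L K u z \<longleftrightarrow>
    C2_halfline u \<and>
    (\<forall>t\<ge>0. z t \<in> Z \<and> G (z t) = u t \<and>
      (z has_vector_derivative L (z t)) (at t within {0..}) \<and>
      ((\<lambda>s. graph_norm G L K (z s - z t)) \<longlongrightarrow> 0) (at t within {0..})) \<and>
    continuous_on {0..} (\<lambda>t. L (z t))"

definition scattering_passive_node ::
    "'x::complex_hilbert set \<Rightarrow> ('x \<Rightarrow> 'u::complex_hilbert) \<Rightarrow> ('x \<Rightarrow> 'x)
      \<Rightarrow> ('x \<Rightarrow> 'y::complex_hilbert) \<Rightarrow> bool"
  where "scattering_passive_node Z G L K \<longleftrightarrow>
    internally_wellposed_node Z G L K \<and>
    (\<forall>u z. smooth_solution Z G L K u z \<longrightarrow>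
      (\<forall>t\<ge>0. \<exists>D. ((\<lambda>s. (norm (z s))\<^sup>2) has_real_derivative D) (at t within {0..}) \<and>
        D + (norm (K (z t)))\<^sup>2 \<le> (norm (u t))\<^sup>2))"

definition X1_norm :: "('x::complex_hilbert \<Rightarrow> 'x) \<Rightarrow> 'x \<Rightarrow> real"
  where "X1_norm L z = norm (z - L z)"

section \<open>Hilbert spaces carried by a subspace\<close>

text \<open>
  A linear subspace \<open>W\<close> of the ambient space, equipped with an inner product \<open>ip\<close> of its own.
  No relation between \<open>ip\<close> and the ambient inner product is required.
\<close>

definition ip_norm :: "('a \<Rightarrow> 'a \<Rightarrow> complex) \<Rightarrow> 'a \<Rightarrow> real"
  where "ip_norm ip x = sqrt (Re (ip x x))"

definition hilbert_space_on ::
    "'a::complex_hilbert set \<Rightarrow> ('a \<Rightarrow> 'a \<Rightarrow> complex) \<Rightarrow> bool"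
  where "hilbert_space_on W ip \<longleftrightarrow>
    csubspace W \<and>
    (\<forall>x\<in>W. \<forall>y\<in>W. ip x y = cnj (ip y x)) \<and>
    (\<forall>x\<in>W. \<forall>y\<in>W. \<forall>z\<in>W. ip x (y + z) = ip x y + ip x z) \<and>
    (\<forall>c. \<forall>x\<in>W. \<forall>y\<in>W. ip x (c *\<^sub>C y) = c * ip x y) \<and>
    (\<forall>x\<in>W. x \<noteq> 0 \<longrightarrow> Re (ip x x) > 0) \<and>
    (\<forall>f::nat \<Rightarrow> 'a. range f \<subseteq> W \<and>
        (\<forall>e>0. \<exists>N. \<forall>m\<ge>N. \<forall>n\<ge>N. ip_norm ip (f m - f n) < e) \<longrightarrow>
      (\<exists>l\<in>W. (\<lambda>n. ip_norm ip (f n - l)) \<longlonglongrightarrow> 0))"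

text \<open>
  The inclusion of \<open>V\<close> (normed by \<open>nV\<close>) into \<open>W\<close> (normed by \<open>nW\<close>) is a compact operator:
  it maps bounded sequences to sequences with a convergent subsequence.
\<close>

definition compact_inclusion ::
    "'a::real_vector set \<Rightarrow> ('a \<Rightarrow> real) \<Rightarrow> 'a set \<Rightarrow> ('a \<Rightarrow> real) \<Rightarrow> bool"
  where "compact_inclusion V nV W nW \<longleftrightarrow> V \<subseteq> W \<and>
    (\<forall>f::nat \<Rightarrow> 'a. range f \<subseteq> V \<and> (\<exists>C. \<forall>n. nV (f n) \<le> C) \<longrightarrow>
      (\<exists>l\<in>W. \<exists>r. strict_mono r \<and> (\<lambda>n. nW (f (r n) - l)) \<longlonglongrightarrow> 0))"

definition bounded_clinear_on ::
    "'a::complex_hilbert set \<Rightarrow> ('a \<Rightarrow> real) \<Rightarrow> ('a \<Rightarrow> 'b::complex_hilbert) \<Rightarrow> bool"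
  where "bounded_clinear_on W nW f \<longleftrightarrow>
    clinear_on W f \<and> (\<exists>C. \<forall>x\<in>W. norm (f x) \<le> C * nW x)"

end

theory Submission
  imports Defs
begin

text \<open>
  Testing passivity on the trajectories \<open>exp t *\<^sub>R w + T t v\<close> with \<open>L w = w\<close> and \<open>v \<in> ker G\<close> turns it
  into the static inequality \<open>2 Re \<langle>z, L z\<rangle> + \<parallel>K z\<parallel>\<^sup>2 \<le> \<parallel>G z\<parallel>\<^sup>2\<close> on \<open>Z\<close>, which survives the addition of a
  dissipative \<open>H\<close>. A dissipative \<open>H\<close> with dense domain is closable, so Ehrling's argument reduces (ii)
  to (i). Under (i), \<open>H\<close> is relatively bounded with bound less than one, the resolvent of \<open>A + H\<close> comes
  from a contraction, and \<open>A + H\<close> generates a contraction semigroup by the Lumer--Phillips theorem.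
  Closedness of the perturbed node follows from the estimate
  \<open>\<parallel>L z\<parallel> \<le> M (\<parallel>z\<parallel> + \<parallel>G z\<parallel> + \<parallel>(L + H) z\<parallel>)\<close>, obtained by splitting \<open>z = w + v\<close> as above.
\<close>

subsection \<open>Linear operators on subspaces\<close>

text \<open>The static inequality is equivalent to passivity: it is the balance at time zero on a
  trajectory through \<open>z\<close>, and conversely it gives the balance at each time along any
  smooth solution, whose derivative is \<open>L z\<close>. The perturbation is therefore carried out
  on one inequality between vectors. Every \<open>z\<close> lies on an explicit trajectory:
  \<open>1 - L\<close> maps \<open>ker G\<close> onto the whole space, so some \<open>v\<close> in
  \<open>ker G\<close> satisfies \<open>v - L v = z - L z\<close>, and \<open>w = z - v\<close> is
  left with \<open>L w = w\<close>. The obstacle is that the bound obtained from (i) or (ii)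
  controls \<open>H\<close> on \<open>ker G\<close> only, while closedness of the perturbed node
  concerns all of \<open>Z\<close>. On the complement \<open>ker (1 - L)\<close> the inequality
  bounds the norm of \<open>w\<close> by that of \<open>G w\<close>, so \<open>G\<close> is a
  bijection from \<open>ker (1 - L)\<close> onto the input space with continuous inverse. The closed
  graph theorem, applied on the input space, then supplies the missing bound on
  \<open>H\<close>.\<close>

definition real_linear_on :: "'a::real_vector set \<Rightarrow> ('a \<Rightarrow> 'b::real_vector) \<Rightarrow> bool"
  where "real_linear_on S f \<longleftrightarrow> subspace S \<and>
    (\<forall>x\<in>S. \<forall>y\<in>S. f (x + y) = f x + f y) \<and> (\<forall>c. \<forall>x\<in>S. f (c *\<^sub>R x) = c *\<^sub>R f x)"

lemma real_linear_onD:
  assumes "real_linear_on S f"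
  shows real_linear_on_subspace: "subspace S"
    and real_linear_on_add: "x \<in> S \<Longrightarrow> y \<in> S \<Longrightarrow> f (x + y) = f x + f y"
    and real_linear_on_scale: "x \<in> S \<Longrightarrow> f (c *\<^sub>R x) = c *\<^sub>R f x"
  using assms by (auto simp: real_linear_on_def)

lemma real_linear_on_zero: "real_linear_on S f \<Longrightarrow> f 0 = 0"
  using real_linear_on_scale[of S f 0 0] real_linear_on_subspace[of S f] subspace_0 by auto

lemma real_linear_on_minus: "real_linear_on S f \<Longrightarrow> x \<in> S \<Longrightarrow> f (- x) = - f x"
  using real_linear_on_scale[of S f x "-1"] by simp

lemma real_linear_on_diff:
  assumes f: "real_linear_on S f" and "x \<in> S" "y \<in> S"
  shows "f (x - y) = f x - f y"
  using real_linear_on_add[OF f, of x "- y"] real_linear_on_minus[OF f, of y] assms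
    subspace_neg[OF real_linear_on_subspace[OF f]] by simp

lemma real_linear_on_subset: "real_linear_on S f \<Longrightarrow> subspace T \<Longrightarrow> T \<subseteq> S \<Longrightarrow> real_linear_on T f"
  unfolding real_linear_on_def by blast

lemma csubspace_imp_subspace: "csubspace S \<Longrightarrow> subspace S"
  by (auto simp: csubspace_def subspace_def scaleR_scaleC)

text \<open>Estimates and limits run over the real scalars, because dissipativity is a statement
  about the real inner product. Complex homogeneity of the constructed semigroup is recovered
  separately in \<open>Lumer_Phillips\<close>.\<close>

lemma clinear_on_imp_real_linear_on: "clinear_on S f \<Longrightarrow> real_linear_on S f"
  unfolding clinear_on_def real_linear_on_def by (auto simp: csubspace_imp_subspace scaleR_scaleC)

lemma bounded_clinear_imp_bounded_linear:
  assumes "bounded_clinear f" shows "bounded_linear f"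
proof -
  obtain C where C: "norm (f x) \<le> C * norm x" for x
    using assms by (auto simp: bounded_clinear_def)
  have "real_linear_on UNIV f"
    using assms by (simp add: bounded_clinear_def clinear_on_imp_real_linear_on)
  then show ?thesis
    by (intro bounded_linear_intro[of f C])
      (auto simp: real_linear_on_def C mult.commute)
qed

lemma closed_op_iff_sequentially:
  fixes f :: "'a::metric_space \<Rightarrow> 'b::metric_space"
  shows "closed_op (D, f) \<longleftrightarrow>
    (\<forall>x l m. (\<forall>n. x n \<in> D) \<and> x \<longlonglongrightarrow> l \<and> (\<lambda>n. f (x n)) \<longlonglongrightarrow> m \<longrightarrow> l \<in> D \<and> f l = m)"
  (is "?L = ?R")
proof
  assume L: ?L
  show ?R
  proof (intro allI impI)
    fix x l m assume a: "(\<forall>n. x n \<in> D) \<and> x \<longlonglongrightarrow> l \<and> (\<lambda>n. f (x n)) \<longlonglongrightarrow> m"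
    have "(l, m) \<in> {(x, op_fun (D, f) x) | x. x \<in> op_dom (D, f)}"
    proof (rule closed_sequentially)
      show "closed {(x, op_fun (D, f) x) | x. x \<in> op_dom (D, f)}" using L by (simp add: closed_op_def)
      show "(\<lambda>n. (x n, f (x n))) \<longlonglongrightarrow> (l, m)" using a by (auto intro: tendsto_Pair)
    qed (use a in \<open>auto simp: op_dom_def op_fun_def\<close>)
    then show "l \<in> D \<and> f l = m" by (auto simp: op_dom_def op_fun_def)
  qed
next
  assume R: ?R
  have "closed {(x, f x) | x. x \<in> D}"
    unfolding closed_sequential_limits
  proof (intro allI impI)
    fix p l assume a: "(\<forall>n. p n \<in> {(x, f x) |x. x \<in> D}) \<and> p \<longlonglongrightarrow> l"
    then have p: "p n \<in> {(x, f x) |x. x \<in> D}" for n by blast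
    have pn: "fst (p n) \<in> D" "snd (p n) = f (fst (p n))" for n using p[of n] by auto
    from a have "(\<lambda>n. fst (p n)) \<longlonglongrightarrow> fst l" "(\<lambda>n. snd (p n)) \<longlonglongrightarrow> snd l"
      by (auto intro: tendsto_fst tendsto_snd)
    then have "fst l \<in> D \<and> f (fst l) = snd l"
      using pn by (intro R[rule_format, of "\<lambda>n. fst (p n)"]) simp
    then show "l \<in> {(x, f x) |x. x \<in> D}" by (auto intro!: exI[of _ "fst l"] simp: prod_eq_iff)
  qed
  then show ?L by (simp add: closed_op_def op_dom_def op_fun_def)
qed

lemma closed_opD:
  fixes f :: "'a::metric_space \<Rightarrow> 'b::metric_space"
  assumes "closed_op (D, f)" "\<And>n. x n \<in> D" "x \<longlonglongrightarrow> l" "(\<lambda>n. f (x n)) \<longlonglongrightarrow> m"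
  shows "l \<in> D" "f l = m"
  using assms unfolding closed_op_iff_sequentially by blast+

subsection \<open>Baire category and the closed graph theorem\<close>

text \<open>Baire's theorem is applied inside the closed set \<open>S\<close> with its subspace
  topology, so that it serves operators defined on a closed subspace, such as the graph of another
  operator, as well as the whole space.\<close>

lemma Baire_ball:
  fixes S :: "'a::complete_space set" and F :: "nat \<Rightarrow> 'a set"
  assumes S: "closed S" "S \<noteq> {}" and F: "\<And>n. closed (F n)" and cov: "S \<subseteq> (\<Union>n. F n)"
  obtains n x r where "x \<in> S" "r > 0" "ball x r \<inter> S \<subseteq> F n"
proof -
  let ?X = "top_of_set S"
  have "\<exists>n. ?X interior_of (S \<inter> F n) \<noteq> {}"
  proof (rule ccontr)
    assume none: "\<not> ?thesis"
    have "?X interior_of \<Union>(range (\<lambda>n. S \<inter> F n)) = {}"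
    proof (rule Baire_category_alt)
      show "completely_metrizable_space ?X \<or> locally_compact_space ?X \<and> regular_space ?X"
        using completely_metrizable_space_closedin[OF completely_metrizable_space_euclidean, of S] S
        by simp
      fix T assume "T \<in> range (\<lambda>n. S \<inter> F n)"
      then show "closedin ?X T \<and> ?X interior_of T = {}"
        using none F by (auto simp: closedin_closed_Int)
    qed auto
    moreover have "\<Union>(range (\<lambda>n. S \<inter> F n)) = topspace ?X" using cov by auto
    ultimately have "?X interior_of (topspace ?X) = {}" by simp
    then show False using S by (simp only: interior_of_topspace) simp
  qed
  then obtain n x where "x \<in> ?X interior_of (S \<inter> F n)" by auto
  then obtain U where U: "openin ?X U" "x \<in> U" "U \<subseteq> S \<inter> F n"
    unfolding interior_of_def by auto
  then obtain e where "e > 0" "ball x e \<inter> S \<subseteq> U" unfolding openin_contains_ball by blast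
  then show thesis using that[of x e n] U by blast
qed

text \<open>Baire yields a ball of \<open>S\<close> on which points are approximated by points with
  bounded image. Rescaling gives an approximation that halves the remainder at bounded cost, and
  iterating it writes \<open>f x\<close> as a geometrically dominated series.\<close>

theorem closed_graph:
  fixes S :: "'a::banach set" and f :: "'a \<Rightarrow> 'b::banach"
  assumes S: "closed S" and f: "real_linear_on S f" and graph: "closed_op (S, f)"
  obtains C where "C > 0" "\<And>x. x \<in> S \<Longrightarrow> norm (f x) \<le> C * norm x"
proof -
  have sub: "subspace S" using f by (rule real_linear_on_subspace)
  note [simp] = subspace_0[OF sub] real_linear_on_zero[OF f]
  define F where "F k = closure {x \<in> S. norm (f x) \<le> real k}" for k
  have cov: "S \<subseteq> (\<Union>k. F k)"
  proof
    fix x assume "x \<in> S"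
    moreover obtain k where "norm (f x) \<le> real k" using real_arch_simple by blast
    ultimately have "x \<in> F k" unfolding F_def using closure_subset by fastforce
    then show "x \<in> (\<Union>k. F k)" by auto
  qed
  obtain k x0 r where x0: "x0 \<in> S" "r > 0" "ball x0 r \<inter> S \<subseteq> F k"
    by (rule Baire_ball[of S F]) (use S cov in \<open>auto simp: F_def intro: subspace_0[OF sub]\<close>)
  \<comment> \<open>The ball found by Baire is centred at \<open>x0\<close>; subtracting
    approximants of \<open>x0 + x\<close> and \<open>x0\<close> recentres it at the origin and
    doubles the bound.\<close>
  have approx1: "\<exists>x'\<in>S. norm (x - x') < e \<and> norm (f x') \<le> 2 * real k"
    if x: "x \<in> S" "norm x < r" and e: "e > 0" for x e
  proof -
    have "x0 + x \<in> F k" "x0 \<in> F k" using x x0 subspace_add[OF sub] by (auto simp: dist_norm)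
    then have "\<exists>a\<in>S. norm (f a) \<le> k \<and> dist a (x0 + x) < e / 2"
      "\<exists>b\<in>S. norm (f b) \<le> k \<and> dist b x0 < e / 2"
      unfolding F_def closure_approachable using half_gt_zero[OF e] by blast+
    then obtain a b where a: "a \<in> S" "norm (f a) \<le> k" "dist a (x0 + x) < e / 2"
      and b: "b \<in> S" "norm (f b) \<le> k" "dist b x0 < e / 2" by blast
    have "norm (x - (a - b)) = norm ((b - x0) - (a - (x0 + x)))" by (simp add: algebra_simps)
    also have "\<dots> < e" using norm_triangle_ineq4[of "b - x0" "a - (x0 + x)"] a b
      by (simp add: dist_norm)
    finally have "norm (x - (a - b)) < e" .
    moreover have "norm (f (a - b)) \<le> 2 * real k"
      using real_linear_on_diff[OF f] a b norm_triangle_ineq4[of "f a" "f b"] by simp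
    moreover have "a - b \<in> S" using subspace_diff[OF sub] a b by simp
    ultimately show ?thesis by (intro bexI[of _ "a - b"] conjI)
  qed
  \<comment> \<open>Rescaling \<open>x\<close> to norm \<open>r / 2\<close> costs the factor
    \<open>2 * norm x / r\<close> on the bound \<open>2 * (real k + 1)\<close>; the added 1 keeps
    \<open>c\<close> positive when \<open>k = 0\<close>.\<close>
  define c where "c = 4 * (real k + 1) / r"
  have cpos: "c > 0" using x0 by (simp add: c_def)
  have approx2: "\<exists>x'\<in>S. norm (x - x') \<le> norm x / 2 \<and> norm (f x') \<le> c * norm x" if x: "x \<in> S" for x
  proof (cases "x = 0")
    case True then show ?thesis by (intro bexI[of _ 0]) auto
  next
    case False
    define s where "s = r / (2 * norm x)"
    have s: "s > 0" using False x0 by (simp add: s_def)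
    have "norm (s *\<^sub>R x) < r" using False x0 s by (simp add: s_def)
    then obtain y where y: "y \<in> S" "norm (s *\<^sub>R x - y) < s * norm x / 2" "norm (f y) \<le> 2 * k"
      using approx1[of "s *\<^sub>R x" "s * norm x / 2"] False s x subspace_scale[OF sub] by auto
    have "s *\<^sub>R (x - (1/s) *\<^sub>R y) = s *\<^sub>R x - y" using s by (simp add: algebra_simps)
    then have "s * norm (x - (1/s) *\<^sub>R y) = norm (s *\<^sub>R x - y)"
      using s by (metis abs_of_pos norm_scaleR)
    then have "norm (x - (1/s) *\<^sub>R y) \<le> norm x / 2"
      using y s by (smt (verit) mult_less_cancel_left_pos times_divide_eq_right)
    moreover have "norm (f ((1/s) *\<^sub>R y)) \<le> c * norm x"
    proof -
      have "norm (f ((1/s) *\<^sub>R y)) = norm (f y) / s" using real_linear_on_scale[OF f] y s by simp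
      also have "\<dots> \<le> (2 * (real k + 1)) / s" using y s by (intro divide_right_mono) auto
      also have "\<dots> = c * norm x" using s x0 False by (simp add: s_def c_def field_simps)
      finally show ?thesis .
    qed
    moreover have "(1/s) *\<^sub>R y \<in> S" using subspace_scale[OF sub] y by simp
    ultimately show ?thesis by (intro bexI[of _ "(1/s) *\<^sub>R y"] conjI)
  qed
  then obtain g where g: "\<And>x. x \<in> S \<Longrightarrow> g x \<in> S" "\<And>x. x \<in> S \<Longrightarrow> norm (x - g x) \<le> norm x / 2"
    "\<And>x. x \<in> S \<Longrightarrow> norm (f (g x)) \<le> c * norm x" by metis
  have "norm (f x) \<le> 2 * c * norm x" if x: "x \<in> S" for x
  proof -
    define \<rho> where "\<rho> n = ((\<lambda>y. y - g y) ^^ n) x" for n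
    have \<rho>Suc: "\<rho> (Suc n) = \<rho> n - g (\<rho> n)" for n by (simp add: \<rho>_def)
    have \<rho>S: "\<rho> n \<in> S" for n
      by (induction n) (use x g subspace_diff[OF sub] in \<open>auto simp: \<rho>Suc, simp add: \<rho>_def\<close>)
    have \<rho>le: "norm (\<rho> n) \<le> norm x * (1/2)^n" for n
    proof (induction n)
      case (Suc n) then show ?case using g(2)[OF \<rho>S[of n]] by (simp add: \<rho>Suc)
    qed (simp add: \<rho>_def)
    have step: "f (\<rho> n) - f (\<rho> (Suc n)) = f (g (\<rho> n))" for n
      using real_linear_on_diff[OF f] \<rho>S g by (simp add: \<rho>Suc)
    have steple: "norm (f (g (\<rho> n))) \<le> c * norm x * (1/2)^n" for n
    proof -
      have "norm (f (g (\<rho> n))) \<le> c * norm (\<rho> n)" using g(3)[OF \<rho>S] .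
      also have "\<dots> \<le> c * (norm x * (1/2)^n)" using \<rho>le cpos by (intro mult_left_mono) auto
      finally show ?thesis by (simp add: mult.assoc)
    qed
    have geo: "(\<lambda>n. c * norm x * (1/2)^n) sums (c * norm x * 2)"
      using sums_mult[OF geometric_sums[of "1/2::real"], of "c * norm x"] by simp
    have sum: "summable (\<lambda>n. norm (f (g (\<rho> n))))"
      by (rule summable_comparison_test[OF _ sums_summable[OF geo]]) (use steple in auto)
    have part: "(\<Sum>i<n. f (g (\<rho> i))) = f x - f (\<rho> n)" for n
    proof (induction n)
      case (Suc n) then show ?case using step[of n] by (simp add: algebra_simps)
    qed (simp add: \<rho>_def)
    have "(\<lambda>n. f x - f (\<rho> n)) \<longlonglongrightarrow> (\<Sum>i. f (g (\<rho> i)))"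
      using summable_LIMSEQ[OF summable_norm_cancel[OF sum]] by (simp add: part)
    then have "(\<lambda>n. f x - (f x - f (\<rho> n))) \<longlonglongrightarrow> f x - (\<Sum>i. f (g (\<rho> i)))"
      by (intro tendsto_diff tendsto_const)
    then have lim: "(\<lambda>n. f (\<rho> n)) \<longlonglongrightarrow> f x - (\<Sum>i. f (g (\<rho> i)))" by simp
    have "(\<lambda>n. norm x * (1/2)^n) \<longlonglongrightarrow> 0"
      by (intro tendsto_mult_right_zero LIMSEQ_power_zero) auto
    then have "\<rho> \<longlonglongrightarrow> 0" by (rule Lim_null_comparison[rotated]) (use \<rho>le in auto)
    \<comment> \<open>The remainders tend to zero while their images converge, so closedness
      identifies the limit of the images with \<open>f 0 = 0\<close>.\<close>
    from closed_opD(2)[OF graph \<rho>S this lim] have "f x = (\<Sum>i. f (g (\<rho> i)))" by simp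
    also have "norm \<dots> \<le> (\<Sum>i. norm (f (g (\<rho> i))))" by (rule summable_norm[OF sum])
    also have "\<dots> \<le> c * norm x * 2"
      using suminf_le[OF steple sum sums_summable[OF geo]] sums_unique[OF geo] by simp
    finally show ?thesis by (simp add: algebra_simps)
  qed
  then show thesis using that[of "2 * c"] cpos by auto
qed

subsection \<open>Dissipative operators\<close>

definition dissipative_on :: "'a::real_inner set \<Rightarrow> ('a \<Rightarrow> 'a) \<Rightarrow> bool"
  where "dissipative_on D A \<longleftrightarrow> (\<forall>x\<in>D. inner x (A x) \<le> 0)"

text \<open>Dissipativity tested at \<open>c *\<^sub>R x n + w\<close> becomes, in the limit, an
  inequality affine in \<open>c\<close> with slope \<open>inner w h\<close>. As \<open>c\<close> is
  an arbitrary real number the slope vanishes, so \<open>h\<close> is orthogonal to a dense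
  set.\<close>

lemma densely_defined_dissipative_closable:
  fixes H :: "'a::real_inner \<Rightarrow> 'a"
  assumes H: "real_linear_on D H" and dense: "closure D = UNIV" and diss: "dissipative_on D H"
    and x: "\<And>n. x n \<in> D" "x \<longlonglongrightarrow> 0" "(\<lambda>n. H (x n)) \<longlonglongrightarrow> h"
  shows "h = 0"
proof -
  have sub: "subspace D" using H by (rule real_linear_on_subspace)
  have *: "c * inner w h + inner w (H w) \<le> 0" if w: "w \<in> D" for w c
  proof (rule LIMSEQ_le_const2)
    show "(\<lambda>n. inner (c *\<^sub>R x n + w) (c *\<^sub>R H (x n) + H w)) \<longlonglongrightarrow> c * inner w h + inner w (H w)"
      by (rule tendsto_eq_intros x refl)+ (simp add: inner_add_right)
    have "inner (c *\<^sub>R x n + w) (c *\<^sub>R H (x n) + H w) \<le> 0" for n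
    proof -
      have "c *\<^sub>R x n + w \<in> D" using x w sub by (simp add: subspace_add subspace_scale)
      moreover have "H (c *\<^sub>R x n + w) = c *\<^sub>R H (x n) + H w"
        using real_linear_on_add[OF H] real_linear_on_scale[OF H] x w sub by (simp add: subspace_scale)
      ultimately show ?thesis using diss unfolding dissipative_on_def by metis
    qed
    then show "\<exists>N. \<forall>n\<ge>N. inner (c *\<^sub>R x n + w) (c *\<^sub>R H (x n) + H w) \<le> 0" by blast
  qed
  have orth: "inner w h = 0" if w: "w \<in> D" for w
  proof (rule ccontr)
    assume "inner w h \<noteq> 0"
    \<comment> \<open>This \<open>c\<close> makes the left-hand side of the inequality equal to
      1.\<close>
    then show False using *[OF w, of "(1 - inner w (H w)) / inner w h"] by simp
  qed
  obtain y where y: "\<And>n. y n \<in> D" "y \<longlonglongrightarrow> h"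
    using dense closure_sequential[of h D] by auto
  have "(\<lambda>n. inner (y n) h) \<longlonglongrightarrow> inner h h" by (intro tendsto_intros y)
  then have "inner h h = 0" using orth y(1) LIMSEQ_unique[OF tendsto_const] by fastforce
  then show ?thesis by simp
qed

text \<open>Ehrling's argument; a limit in \<open>W\<close> need not be a limit in the ambient space, and
  closability replaces the continuity of the inclusion of \<open>W\<close>.\<close>

lemma compact_inclusion_imp_relative_bound:
  fixes H :: "'a::complex_hilbert \<Rightarrow> 'a"
  assumes H: "real_linear_on D H" and dense: "closure D = UNIV" and diss: "dissipative_on D H"
    and L: "real_linear_on D0 L" and D0: "D0 \<subseteq> D"
    and W: "D0 \<subseteq> W"
    and cpt: "compact_inclusion D0 (X1_norm L) W (ip_norm ip)"
    and bdd: "bounded_clinear_on W (ip_norm ip) H" and e: "e > 0"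
  obtains a where "a > 0" "\<And>z. z \<in> D0 \<Longrightarrow> norm (H z) \<le> a * norm z + e * norm (L z)"
proof (rule ccontr)
  assume "\<not> thesis"
  then have "\<exists>z\<in>D0. norm (H z) > real (Suc n) * norm z + e * norm (L z)" for n
    using that[of "real (Suc n)"] by force
  then obtain z where z: "\<And>n. z n \<in> D0"
    "\<And>n. norm (H (z n)) > real (Suc n) * norm (z n) + e * norm (L (z n))" by metis
  have Hpos: "norm (H (z n)) > 0" for n
    using z(2)[of n] e by (smt (verit) mult_nonneg_nonneg norm_ge_zero of_nat_0_le_iff)
  \<comment> \<open>Normalising the counterexamples by \<open>H\<close> makes \<open>y n\<close>
    tend to zero in the ambient norm while its \<open>X1_norm\<close> stays bounded and
    \<open>H (y n)\<close> keeps norm one. Compactness then produces a nonzero limit of the images,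
    against closability.\<close>
  define y where "y n = (1 / norm (H (z n))) *\<^sub>R z n" for n
  have sub0: "subspace D0" using L by (rule real_linear_on_subspace)
  have y0: "y n \<in> D0" for n using z sub0 by (simp add: y_def subspace_scale)
  have Hy: "norm (H (y n)) = 1" for n
    using real_linear_on_scale[OF H] z D0 Hpos[of n] by (auto simp: y_def subset_iff)
  have small: "real (Suc n) * norm (y n) + e * norm (L (y n)) < 1" for n
  proof -
    have "real (Suc n) * norm (y n) + e * norm (L (y n))
        = (real (Suc n) * norm (z n) + e * norm (L (z n))) / norm (H (z n))"
      using real_linear_on_scale[OF L z(1)] by (simp add: y_def add_divide_distrib)
    also have "\<dots> < 1" using z(2)[of n] Hpos[of n] by (simp add: divide_less_eq)
    finally show ?thesis .
  qed
  have ny: "norm (y n) \<le> 1 / real (Suc n)" for n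
  proof -
    have "real (Suc n) * norm (y n) \<le> 1" using small[of n] e
      by (smt (verit) mult_nonneg_nonneg norm_ge_zero)
    then show ?thesis by (simp add: pos_le_divide_eq mult.commute)
  qed
  then have y_lim: "y \<longlonglongrightarrow> 0" by (intro Lim_null_comparison[OF _ lim_inverse_n'[THEN LIMSEQ_Suc]]) auto
  have "X1_norm L (y n) \<le> 1 + 1 / e" for n
  proof -
    have "e * norm (L (y n)) \<le> 1" using small[of n]
      by (smt (verit) mult_nonneg_nonneg norm_ge_zero of_nat_0_le_iff)
    then have "norm (L (y n)) \<le> 1 / e" using e by (simp add: pos_le_divide_eq mult.commute)
    moreover have "norm (y n) \<le> 1"
      using ny[of n] by (smt (verit) divide_le_eq_1 of_nat_Suc of_nat_0_le_iff)
    ultimately show ?thesis unfolding X1_norm_def using norm_triangle_ineq4[of "y n" "L (y n)"] by simp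
  qed
  then obtain l r where l: "l \<in> W" "strict_mono r" "(\<lambda>n. ip_norm ip (y (r n) - l)) \<longlonglongrightarrow> 0"
    using cpt y0 unfolding compact_inclusion_def by (metis image_subsetI)
  obtain C where C: "\<And>x. x \<in> W \<Longrightarrow> norm (H x) \<le> C * ip_norm ip x" and HW: "real_linear_on W H"
    using bdd unfolding bounded_clinear_on_def by (auto dest: clinear_on_imp_real_linear_on)
  have "norm (H (y (r n)) - H l) \<le> C * ip_norm ip (y (r n) - l)" for n
    using C[of "y (r n) - l"] real_linear_on_diff[OF HW] l W y0[of "r n"]
      subspace_diff[OF real_linear_on_subspace[OF HW]] by (auto simp: subset_iff)
  then have "(\<lambda>n. H (y (r n)) - H l) \<longlonglongrightarrow> 0"
    by (intro Lim_null_comparison[OF _ tendsto_mult_right_zero[OF l(3), of C]]) auto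
  then have Hlim: "(\<lambda>n. H (y (r n))) \<longlonglongrightarrow> H l" by (simp add: Lim_null[of _ "H l"])
  have "H l = 0"
    by (rule densely_defined_dissipative_closable[OF H dense diss _ _ Hlim])
      (use y0 D0 LIMSEQ_subseq_LIMSEQ[OF y_lim l(2)] in \<open>auto simp: comp_def\<close>)
  moreover have "norm (H l) = 1"
    using tendsto_norm[OF Hlim] Hy by (simp add: LIMSEQ_const_iff)
  ultimately show False by simp
qed

subsection \<open>Exponentials of bounded operators\<close>

lemma norm_funpow_le:
  fixes B :: "'a::real_normed_vector \<Rightarrow> 'a"
  assumes "\<And>x. norm (B x) \<le> norm x * C" "C \<ge> 0"
  shows "norm ((B ^^ k) x) \<le> C ^ k * norm x"
proof (induction k)
  case (Suc k)
  have "norm (B ((B ^^ k) x)) \<le> norm ((B ^^ k) x) * C" by (rule assms)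
  also have "\<dots> \<le> C ^ k * norm x * C" using Suc assms by (intro mult_right_mono) auto
  finally show ?case by (simp add: mult_ac)
qed simp

text \<open>The exponential of \<open>t B\<close>, with its series summed at the vector
  \<open>x\<close> rather than in the operator norm.\<close>

definition expo :: "('a::banach \<Rightarrow> 'a) \<Rightarrow> real \<Rightarrow> 'a \<Rightarrow> 'a"
  where "expo B t x = (\<Sum>k. (t ^ k / fact k) *\<^sub>R (B ^^ k) x)"

lemma expo_sums:
  assumes B: "bounded_linear B"
  shows "(\<lambda>k. (t ^ k / fact k) *\<^sub>R (B ^^ k) x) sums expo B t x"
proof -
  obtain C where C: "C \<ge> 0" "\<And>x. norm (B x) \<le> norm x * C"
    using bounded_linear.nonneg_bounded[OF B] by blast
  have "summable (\<lambda>k. norm x * ((\<bar>t\<bar> * C) ^ k / fact k))"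
    using summable_mult[OF summable_exp_generic[of "\<bar>t\<bar> * C"]] by (simp add: field_simps)
  then have "summable (\<lambda>k. norm ((t ^ k / fact k) *\<^sub>R (B ^^ k) x))"
  proof (rule summable_comparison_test[rotated], intro exI allI impI)
    fix k
    have "\<bar>t\<bar> ^ k / fact k * norm ((B ^^ k) x) \<le> \<bar>t\<bar> ^ k / fact k * (C ^ k * norm x)"
      by (intro mult_left_mono norm_funpow_le C) auto
    then show "norm (norm ((t ^ k / fact k) *\<^sub>R (B ^^ k) x)) \<le> norm x * ((\<bar>t\<bar> * C) ^ k / fact k)"
      by (simp add: power_abs power_mult_distrib field_simps)
  qed
  then show ?thesis unfolding expo_def by (rule summable_sums[OF summable_norm_cancel])
qed

lemma expo_0 [simp]: "expo B 0 x = x"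
  unfolding expo_def by (subst suminf_finite[of "{0}"]) auto

lemma expo_add:
  assumes B: "bounded_linear B"
  shows "expo B t (x + y) = expo B t x + expo B t y"
proof -
  have "(B ^^ k) (x + y) = (B ^^ k) x + (B ^^ k) y" for k
    by (induction k) (simp_all add: linear_add[OF bounded_linear.linear[OF B]])
  then have "(\<lambda>k. (t ^ k / fact k) *\<^sub>R (B ^^ k) (x + y)) sums (expo B t x + expo B t y)"
    using sums_add[OF expo_sums[OF B, of t x] expo_sums[OF B, of t y]] by (simp add: scaleR_add_right)
  then show ?thesis by (rule sums_unique2[OF expo_sums[OF B]])
qed

lemma expo_commute:
  assumes B: "bounded_linear B" and S: "bounded_linear S" and SB: "\<And>x. S (B x) = B (S x)"
  shows "expo B t (S x) = S (expo B t x)"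
proof -
  have "(B ^^ k) (S x) = S ((B ^^ k) x)" for k
    by (induction k) (simp_all add: SB)
  then have "(\<lambda>k. (t ^ k / fact k) *\<^sub>R (B ^^ k) (S x)) sums S (expo B t x)"
    using bounded_linear.sums[OF S expo_sums[OF B, of t x]]
    by (simp add: linear_scale[OF bounded_linear.linear[OF S]])
  then show ?thesis by (rule sums_unique2[OF expo_sums[OF B]])
qed

text \<open>The series is differentiated term by term on a bounded interval around \<open>t\<close>.
  The differentiated series is the exponential series at \<open>B x\<close>, which converges
  uniformly there by the Weierstrass test.\<close>

lemma expo_has_vector_derivative:
  assumes B: "bounded_linear B"
  shows "((\<lambda>t. expo B t x) has_vector_derivative B (expo B t x)) (at t)"
proof -
  obtain C where C: "C \<ge> 0" "\<And>x. norm (B x) \<le> norm x * C"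
    using bounded_linear.nonneg_bounded[OF B] by blast
  define R where "R = \<bar>t\<bar> + 1"
  define S where "S = {-R<..<R}"
  have S: "convex S" "open S" "t \<in> S" by (auto simp: S_def R_def)
  \<comment> \<open>The constant term has derivative zero, so the first \<open>Suc n\<close>
    derivatives add up to only \<open>n\<close> terms of the series at \<open>B x\<close>; hence the
    threshold \<open>Suc N\<close> below.\<close>
  define d where "d i s = (if i = 0 then 0 else (s ^ (i - 1) / fact (i - 1)) *\<^sub>R (B ^^ i) x)"
    for i :: nat and s :: real
  have d_sum: "(\<Sum>i<Suc n. d i s) = (\<Sum>i<n. (s ^ i / fact i) *\<^sub>R (B ^^ i) (B x))" for n s
    by (subst sum.lessThan_Suc_shift) (simp add: d_def funpow_swap1)
  have unif: "uniform_limit S (\<lambda>n s. \<Sum>i<n. (s ^ i / fact i) *\<^sub>R (B ^^ i) (B x))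
      (\<lambda>s. expo B s (B x)) sequentially"
    unfolding expo_def
  proof (rule Weierstrass_m_test)
    fix k s assume "s \<in> S"
    then have "\<bar>s\<bar> ^ k \<le> R ^ k" by (intro power_mono) (auto simp: S_def)
    then have "\<bar>s\<bar> ^ k / fact k * norm ((B ^^ k) (B x)) \<le> R ^ k / fact k * (C ^ k * norm (B x))"
      by (intro mult_mono norm_funpow_le C divide_right_mono) (auto simp: R_def)
    then show "norm ((s ^ k / fact k) *\<^sub>R (B ^^ k) (B x)) \<le> norm (B x) * ((R * C) ^ k / fact k)"
      by (simp add: power_abs power_mult_distrib field_simps)
  next
    show "summable (\<lambda>k. norm (B x) * ((R * C) ^ k / fact k))"
      using summable_exp_generic[of "R * C"]
      by (intro summable_mult) (simp add: divide_inverse mult.commute)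
  qed
  have "\<exists>g. \<forall>s\<in>S. (\<lambda>n. (s ^ n / fact n) *\<^sub>R (B ^^ n) x) sums g s \<and>
      (g has_derivative (\<lambda>h. h *\<^sub>R expo B s (B x))) (at s within S)"
  proof (rule has_derivative_series[where f' = "\<lambda>i s h. h *\<^sub>R d i s"])
    fix n s assume "s \<in> S"
    have "((\<lambda>s. s ^ n / fact n) has_real_derivative
        (if n = 0 then 0 else s ^ (n - 1) / fact (n - 1))) (at s within S)"
    proof (cases n)
      case (Suc m)
      have "((\<lambda>s. s ^ n / fact n) has_real_derivative (real n * s ^ (n - 1)) / fact n) (at s within S)"
        using DERIV_cdivide[OF DERIV_pow[of n s S], of "fact n"] by simp
      also have "(real n * s ^ (n - 1)) / fact n = s ^ (n - 1) / fact (n - 1)"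
        using Suc by (simp add: field_simps del: of_nat_Suc)
      finally show ?thesis using Suc by simp
    qed simp
    then have "((\<lambda>s. (s ^ n / fact n) *\<^sub>R (B ^^ n) x) has_vector_derivative d n s) (at s within S)"
      using has_vector_derivative_scaleR[OF _ has_vector_derivative_const[of "(B ^^ n) x"]]
      by (cases "n = 0") (fastforce simp: d_def)+
    then show "((\<lambda>s. (s ^ n / fact n) *\<^sub>R (B ^^ n) x) has_derivative (\<lambda>h. h *\<^sub>R d n s)) (at s within S)"
      by (simp add: has_vector_derivative_def)
  next
    fix e :: real assume "e > 0"
    then obtain N where N: "\<And>n s. n \<ge> N \<Longrightarrow> s \<in> S \<Longrightarrow>
        norm ((\<Sum>i<n. (s ^ i / fact i) *\<^sub>R (B ^^ i) (B x)) - expo B s (B x)) < e"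
      using unif unfolding uniform_limit_iff eventually_sequentially dist_norm by blast
    show "\<forall>\<^sub>F n in sequentially. \<forall>s\<in>S. \<forall>h.
        norm ((\<Sum>i<n. h *\<^sub>R d i s) - h *\<^sub>R expo B s (B x)) \<le> e * norm h"
      unfolding eventually_sequentially
    proof (intro exI allI impI ballI)
      fix n s and h :: real assume "Suc N \<le> n" and s: "s \<in> S"
      then obtain m where m: "n = Suc m" "m \<ge> N" by (cases n) auto
      have "norm ((\<Sum>i<n. h *\<^sub>R d i s) - h *\<^sub>R expo B s (B x))
          = norm h * norm ((\<Sum>i<n. d i s) - expo B s (B x))"
        by (metis norm_scaleR real_norm_def scaleR_right_diff_distrib scaleR_sum_right)
      also have "\<dots> \<le> norm h * e"
        using N[OF m(2) s] unfolding m d_sum by (intro mult_left_mono) auto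
      finally show "norm ((\<Sum>i<n. h *\<^sub>R d i s) - h *\<^sub>R expo B s (B x)) \<le> e * norm h"
        by (simp add: mult.commute)
    qed
  next
    show "(\<lambda>n. (t ^ n / fact n) *\<^sub>R (B ^^ n) x) sums expo B t x" by (rule expo_sums[OF B])
  qed (use S in auto)
  then obtain g where g: "\<And>s. s \<in> S \<Longrightarrow> (\<lambda>n. (s ^ n / fact n) *\<^sub>R (B ^^ n) x) sums g s"
    "\<And>s. s \<in> S \<Longrightarrow> (g has_derivative (\<lambda>h. h *\<^sub>R expo B s (B x))) (at s within S)" by blast
  have "(g has_vector_derivative expo B t (B x)) (at t)"
    using g(2)[OF S(3)] at_within_open[OF S(3,2)] by (simp add: has_vector_derivative_def)
  moreover have "g s = expo B s x" if "s \<in> S" for s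
    using sums_unique2[OF g(1)[OF that] expo_sums[OF B]] .
  ultimately have "((\<lambda>s. expo B s x) has_vector_derivative expo B t (B x)) (at t)"
    by (rule has_vector_derivative_transform_within_open[OF _ S(2,3)])
  then show ?thesis by (simp add: expo_commute[OF B B])
qed

subsection \<open>Energy estimates\<close>

lemma has_real_derivative_norm_power2:
  fixes f :: "real \<Rightarrow> 'a::real_inner"
  assumes "(f has_vector_derivative f') (at t within S)"
  shows "((\<lambda>s. (norm (f s))\<^sup>2) has_real_derivative 2 * inner (f t) f') (at t within S)"
proof -
  have "((\<lambda>s. inner (f s) (f s)) has_derivative (\<lambda>h. inner (f t) (h *\<^sub>R f') + inner (h *\<^sub>R f') (f t)))
      (at t within S)"
    using assms unfolding has_vector_derivative_def by (intro has_derivative_inner)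
  then show ?thesis
    unfolding has_field_derivative_def power2_norm_eq_inner
    by (rule has_derivative_eq_rhs) (auto simp: inner_commute)
qed

text \<open>A common tool: with \<open>c = 0\<close> it yields contractivity, and uniqueness when
  applied to a difference of solutions; with positive \<open>c\<close> it compares two Yosida
  semigroups.\<close>

lemma energy_estimate:
  fixes f :: "real \<Rightarrow> 'a::real_inner"
  assumes deriv: "\<And>t. t \<ge> 0 \<Longrightarrow> (f has_vector_derivative f' t) (at t within {0..})"
    and le: "\<And>t. t \<ge> 0 \<Longrightarrow> inner (f t) (f' t) \<le> c" and t: "t \<ge> 0"
  shows "(norm (f t))\<^sup>2 \<le> (norm (f 0))\<^sup>2 + 2 * c * t"
proof -
  let ?g = "\<lambda>s. (norm (f s))\<^sup>2 - 2 * c * s"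
  have g: "(?g has_real_derivative 2 * inner (f s) (f' s) - 2 * c) (at s within {0..})" if "s \<ge> 0" for s
    by (rule derivative_eq_intros has_real_derivative_norm_power2 deriv that refl)+ simp
  have "?g t \<le> ?g 0"
  proof (rule DERIV_nonpos_imp_decreasing_open[OF t])
    fix s :: real assume "0 < s" "s < t"
    then have "(?g has_real_derivative 2 * inner (f s) (f' s) - 2 * c) (at s)"
      using g[of s] at_within_interior[of s "{0..}"] by auto
    moreover have "2 * inner (f s) (f' s) - 2 * c \<le> 0" using le[of s] \<open>0 < s\<close> by simp
    ultimately show "\<exists>y. (?g has_real_derivative y) (at s) \<and> y \<le> 0" by blast
  next
    have "continuous_on {0..} ?g"
      using g by (intro DERIV_continuous_on[where D = "\<lambda>s. 2 * inner (f s) (f' s) - 2 * c"]) auto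
    then show "continuous_on {0..t} ?g" by (rule continuous_on_subset) auto
  qed
  then show ?thesis by simp
qed

lemma expo_contraction:
  fixes B :: "'a::{real_inner,banach} \<Rightarrow> 'a"
  assumes B: "bounded_linear B" "dissipative_on UNIV B" and t: "t \<ge> 0"
  shows "norm (expo B t x) \<le> norm x"
proof -
  have "(norm (expo B t x))\<^sup>2 \<le> (norm (expo B 0 x))\<^sup>2 + 2 * 0 * t"
    by (rule energy_estimate[OF _ _ t, of _ "\<lambda>t. B (expo B t x)"])
      (use B in \<open>auto simp: dissipative_on_def intro: has_vector_derivative_at_within expo_has_vector_derivative\<close>)
  then show ?thesis by (simp add: power2_le_iff_abs_le)
qed

text \<open>Both sides solve \<open>f' = B f\<close> with the same initial value, and by
  dissipativity their difference cannot gain energy.\<close>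

lemma expo_semigroup:
  fixes B :: "'a::{real_inner,banach} \<Rightarrow> 'a"
  assumes B: "bounded_linear B" "dissipative_on UNIV B" and t: "t \<ge> 0"
  shows "expo B (t + s) x = expo B t (expo B s x)"
proof -
  let ?f = "\<lambda>t. expo B (t + s) x - expo B t (expo B s x)"
  have "(norm (?f t))\<^sup>2 \<le> (norm (?f 0))\<^sup>2 + 2 * 0 * t"
  proof (rule energy_estimate[OF _ _ t])
    fix r :: real
    have "((\<lambda>t. t + s) has_vector_derivative 1) (at r)"
      by (auto intro!: derivative_eq_intros)
    then have "((\<lambda>t. expo B (t + s) x) has_vector_derivative B (expo B (r + s) x)) (at r)"
      using vector_diff_chain_at[of "\<lambda>t. t + s" 1 r "\<lambda>t. expo B t x" "B (expo B (r + s) x)"]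
        expo_has_vector_derivative[OF B(1), of x "r + s"]
      by (simp add: o_def)
    then have "(?f has_vector_derivative B (expo B (r + s) x) - B (expo B r (expo B s x))) (at r)"
      by (intro has_vector_derivative_diff expo_has_vector_derivative B)
    then show "(?f has_vector_derivative B (?f r)) (at r within {0..})"
      by (simp add: linear_diff[OF bounded_linear.linear[OF B(1)]] has_vector_derivative_at_within)
  qed (use B in \<open>auto simp: dissipative_on_def\<close>)
  then show ?thesis by simp
qed

lemma nonexpansive_tendsto_on_dense:
  fixes f :: "'i \<Rightarrow> 'a::metric_space \<Rightarrow> 'a"
  assumes ne: "\<forall>\<^sub>F i in F. \<forall>x y. dist (f i x) (f i y) \<le> dist x y"
    and dense: "closure D = UNIV" and lim: "\<And>x. x \<in> D \<Longrightarrow> ((\<lambda>i. f i x) \<longlongrightarrow> x) F"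
  shows "((\<lambda>i. f i x) \<longlongrightarrow> x) F"
proof (rule tendstoI)
  fix e :: real assume e: "e > 0"
  obtain y where y: "y \<in> D" "dist y x < e / 3"
    using dense closure_approachable[of x D] e by (metis UNIV_I divide_pos_pos zero_less_numeral)
  have "\<forall>\<^sub>F i in F. dist (f i y) y < e / 3" using lim[OF y(1)] e by (intro tendstoD) auto
  with ne show "\<forall>\<^sub>F i in F. dist (f i x) x < e"
  proof eventually_elim
    case (elim i)
    have "dist (f i x) (f i y) < e / 3" using elim(1) y(2) by (metis dist_commute le_less_trans)
    then show ?case
      using elim(2) y(2) dist_triangle[of "f i x" x "f i y"] dist_triangle[of "f i y" x y] by linarith
  qed
qed

subsection \<open>The Lumer--Phillips theorem\<close>

text \<open>The range condition is imposed on a half-line of parameters: the perturbed equation will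
  be solved for large parameters, and the Yosida approximation lets the parameter tend to
  infinity.\<close>

locale m_dissipative =
  fixes D :: "'a::{real_inner,banach} set" and A :: "'a \<Rightarrow> 'a" and \<omega> :: real
  assumes A: "real_linear_on D A" and dense: "closure D = UNIV" and dissipative: "dissipative_on D A"
    and \<omega>: "\<omega> > 0" and range: "\<And>\<mu> y. \<mu> \<ge> \<omega> \<Longrightarrow> \<exists>x\<in>D. \<mu> *\<^sub>R x - A x = y"

lemma dissipative_on_lower_bound:
  assumes "dissipative_on D A" "x \<in> D" "\<mu> \<ge> 0"
  shows "(\<mu> * norm x)\<^sup>2 + (norm (A x))\<^sup>2 \<le> (norm (\<mu> *\<^sub>R x - A x))\<^sup>2"
proof -
  have "(norm (\<mu> *\<^sub>R x - A x))\<^sup>2 = (\<mu> * norm x)\<^sup>2 + (norm (A x))\<^sup>2 - 2 * \<mu> * inner x (A x)"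
    unfolding power_mult_distrib power2_norm_eq_inner
    by (simp add: inner_diff inner_commute algebra_simps power2_eq_square)
  moreover have "\<mu> * inner x (A x) \<le> 0"
    using assms by (simp add: dissipative_on_def mult_nonneg_nonpos)
  ultimately show ?thesis by simp
qed

lemma dissipative_on_norm_le:
  assumes "dissipative_on D A" "x \<in> D" "\<mu> \<ge> 0"
  shows "\<mu> * norm x \<le> norm (\<mu> *\<^sub>R x - A x)" "norm (A x) \<le> norm (\<mu> *\<^sub>R x - A x)"
  using dissipative_on_lower_bound[OF assms]
  by (smt (verit) norm_ge_zero power2_le_imp_le zero_le_power2)+

context m_dissipative
begin

section \<open>Resolvents and Yosida approximations\<close>

lemmas subspace_D = real_linear_on_subspace[OF A]
lemmas A_add = real_linear_on_add[OF A]
lemmas A_scale = real_linear_on_scale[OF A]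
lemmas A_diff = real_linear_on_diff[OF A]

text \<open>The normalised resolvent \<open>\<mu> (\<mu> - A)\<^sup>-\<^sup>1\<close>: a contraction
  that tends strongly to the identity as the parameter grows.\<close>

definition J :: "real \<Rightarrow> 'a \<Rightarrow> 'a"
  where "J \<mu> y = (SOME x. x \<in> D \<and> \<mu> *\<^sub>R x - A x = \<mu> *\<^sub>R y)"

lemma J:
  assumes "\<mu> \<ge> \<omega>"
  shows J_in_D: "J \<mu> y \<in> D" and J_eq: "\<mu> *\<^sub>R J \<mu> y - A (J \<mu> y) = \<mu> *\<^sub>R y"
  using someI_ex[of "\<lambda>x. x \<in> D \<and> \<mu> *\<^sub>R x - A x = \<mu> *\<^sub>R y"] range[OF assms, of "\<mu> *\<^sub>R y"]
  unfolding J_def by blast+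

lemma J_unique:
  assumes l: "\<mu> \<ge> \<omega>" and x: "x \<in> D" "\<mu> *\<^sub>R x - A x = \<mu> *\<^sub>R y"
  shows "J \<mu> y = x"
proof -
  have "\<mu> *\<^sub>R (J \<mu> y - x) - A (J \<mu> y - x)
      = (\<mu> *\<^sub>R J \<mu> y - A (J \<mu> y)) - (\<mu> *\<^sub>R x - A x)"
    using A_diff[OF J_in_D[OF l] x(1)] by (simp add: algebra_simps)
  also have "\<dots> = 0" using J_eq[OF l] x by simp
  finally have "\<mu> * norm (J \<mu> y - x) \<le> 0"
    using dissipative_on_norm_le(1)[OF dissipative, of "J \<mu> y - x" \<mu>] l \<omega> x J_in_D[OF l]
    by (simp add: subspace_diff[OF subspace_D])
  then show ?thesis using l \<omega> by (simp add: mult_le_0_iff)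
qed

lemma norm_J_le: "\<mu> \<ge> \<omega> \<Longrightarrow> norm (J \<mu> y) \<le> norm y"
  using dissipative_on_norm_le(1)[OF dissipative J_in_D, of \<mu> \<mu> y] J_eq[of \<mu> y] \<omega> by simp

lemma J_add: "\<mu> \<ge> \<omega> \<Longrightarrow> J \<mu> (x + y) = J \<mu> x + J \<mu> y"
  using J_eq[of \<mu> x] J_eq[of \<mu> y]
  by (intro J_unique) (auto simp: J_in_D A_add subspace_add[OF subspace_D] algebra_simps)

lemma J_commute:
  assumes l: "\<mu> \<ge> \<omega>" and S: "bounded_linear S" and SD: "\<And>x. x \<in> D \<Longrightarrow> S x \<in> D"
    and SA: "\<And>x. x \<in> D \<Longrightarrow> A (S x) = S (A x)"
  shows "J \<mu> (S y) = S (J \<mu> y)"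
proof (rule J_unique[OF l])
  have "\<mu> *\<^sub>R S (J \<mu> y) - A (S (J \<mu> y)) = S (\<mu> *\<^sub>R J \<mu> y - A (J \<mu> y))"
    using SA[OF J_in_D[OF l]] bounded_linear.linear[OF S] by (simp add: linear_diff linear_scale)
  then show "\<mu> *\<^sub>R S (J \<mu> y) - A (S (J \<mu> y)) = \<mu> *\<^sub>R S y"
    using J_eq[OF l] bounded_linear.linear[OF S] by (simp add: linear_scale)
qed (use SD J_in_D[OF l] in auto)

lemma J_scale: "\<mu> \<ge> \<omega> \<Longrightarrow> J \<mu> (c *\<^sub>R y) = c *\<^sub>R J \<mu> y"
  by (rule J_commute) (auto intro: bounded_linear_scaleR_right simp: A_scale subspace_scale[OF subspace_D])

text \<open>The Yosida approximation \<open>A J\<close>, written in the form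
  \<open>\<mu> (J - 1)\<close>, which is visibly bounded and, as \<open>J\<close> is a contraction,
  dissipative.\<close>

definition yosida :: "real \<Rightarrow> 'a \<Rightarrow> 'a"
  where "yosida \<mu> y = \<mu> *\<^sub>R (J \<mu> y - y)"

lemma yosida_eq: "\<mu> \<ge> \<omega> \<Longrightarrow> yosida \<mu> y = A (J \<mu> y)"
  using J_eq[of \<mu> y] by (simp add: yosida_def algebra_simps)

lemma yosida_on_D:
  assumes l: "\<mu> \<ge> \<omega>" and x: "x \<in> D"
  shows "yosida \<mu> x = J \<mu> (A x)"
proof (rule J_unique[OF l, symmetric])
  have d: "J \<mu> x - x \<in> D" using J_in_D[OF l] x by (simp add: subspace_diff[OF subspace_D])
  then show "yosida \<mu> x \<in> D" by (simp add: yosida_def subspace_scale[OF subspace_D])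
  have "\<mu> *\<^sub>R yosida \<mu> x - A (yosida \<mu> x) = \<mu> *\<^sub>R (yosida \<mu> x - A (J \<mu> x) + A x)"
    using d A_scale[OF d] A_diff[OF J_in_D[OF l] x] by (simp add: yosida_def algebra_simps)
  then show "\<mu> *\<^sub>R yosida \<mu> x - A (yosida \<mu> x) = \<mu> *\<^sub>R A x" by (simp add: yosida_eq[OF l])
qed

lemma bounded_linear_yosida:
  assumes l: "\<mu> \<ge> \<omega>" shows "bounded_linear (yosida \<mu>)"
proof (rule bounded_linear_intro)
  show "norm (yosida \<mu> y) \<le> norm y * (2 * \<mu>)" for y
  proof -
    have "norm (J \<mu> y - y) \<le> 2 * norm y"
      using norm_triangle_ineq4[of "J \<mu> y" y] norm_J_le[OF l, of y] by simp
    then show ?thesis using l \<omega> by (simp add: yosida_def mult_ac)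
  qed
qed (auto simp: yosida_def J_add[OF l] J_scale[OF l] algebra_simps)

lemma dissipative_yosida:
  assumes l: "\<mu> \<ge> \<omega>" shows "dissipative_on UNIV (yosida \<mu>)"
  unfolding dissipative_on_def
proof
  fix y
  have "inner y (J \<mu> y) \<le> norm y * norm y"
    by (rule order_trans[OF norm_cauchy_schwarz]) (intro mult_left_mono norm_J_le[OF l], auto)
  then have "inner y (J \<mu> y - y) \<le> 0"
    by (simp add: inner_diff_right dot_square_norm power2_eq_square)
  then show "inner y (yosida \<mu> y) \<le> 0" using l \<omega> by (simp add: yosida_def mult_nonneg_nonpos)
qed

text \<open>For \<open>x\<close> in \<open>D\<close> the error is the Yosida approximation of
  \<open>x\<close> divided by the parameter, hence at most
  \<open>norm (A x) / (\<omega> + real n)\<close>. Nonexpansiveness carries the limit over to the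
  closure of \<open>D\<close>.\<close>

lemma J_tendsto: "(\<lambda>n. J (\<omega> + real n) x) \<longlonglongrightarrow> x"
proof (rule nonexpansive_tendsto_on_dense[OF always_eventually dense])
  have "J \<mu> (x - y) = J \<mu> x - J \<mu> y" if "\<mu> \<ge> \<omega>" for \<mu> x y
    using J_add[OF that, of x "- y"] J_scale[OF that, of "-1" y] by simp
  then show "\<forall>n x y. dist (J (\<omega> + real n) x) (J (\<omega> + real n) y) \<le> dist x y"
    using norm_J_le by (metis dist_norm le_add_same_cancel1 of_nat_0_le_iff)
  fix x assume x: "x \<in> D"
  have "norm (J (\<omega> + real n) x - x) \<le> norm (A x) * (1 / (\<omega> + real n))" for n
  proof -
    have "(\<omega> + real n) * norm (J (\<omega> + real n) x - x) = norm (yosida (\<omega> + real n) x)"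
      using \<omega> by (simp add: yosida_def)
    also have "\<dots> \<le> norm (A x)" using yosida_on_D[OF _ x] norm_J_le by simp
    finally show ?thesis using \<omega> by (simp add: pos_le_divide_eq mult.commute add_pos_nonneg)
  qed
  moreover have "(\<lambda>n. norm (A x) * (1 / (\<omega> + real n))) \<longlonglongrightarrow> 0"
    by real_asymp
  ultimately have "(\<lambda>n. J (\<omega> + real n) x - x) \<longlonglongrightarrow> 0"
    by (rule Lim_null_comparison[OF always_eventually[OF allI]])
  then show "(\<lambda>n. J (\<omega> + real n) x) \<longlonglongrightarrow> x" by (simp add: Lim_null[of _ x])
qed

section \<open>Convergence of the Yosida semigroups\<close>

definition E :: "nat \<Rightarrow> real \<Rightarrow> 'a \<Rightarrow> 'a"
  where "E n = expo (yosida (\<omega> + real n))"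

lemma index_ge: "\<omega> + real n \<ge> \<omega>" by simp

lemmas bounded_linear_yosidan = bounded_linear_yosida[OF index_ge]
lemmas E_norm_le = expo_contraction[OF bounded_linear_yosidan dissipative_yosida[OF index_ge], folded E_def]
lemmas E_semigroup = expo_semigroup[OF bounded_linear_yosidan dissipative_yosida[OF index_ge], folded E_def]
lemmas E_add = expo_add[OF bounded_linear_yosidan, folded E_def]
lemmas E_commute = expo_commute[OF bounded_linear_yosidan, folded E_def]
lemmas E_deriv = expo_has_vector_derivative[OF bounded_linear_yosidan, folded E_def]

lemma E_diff: "E n t (x - y) = E n t x - E n t y"
  using E_add[of n t "x - y" y] by simp

lemma E_nonexpansive: "t \<ge> 0 \<Longrightarrow> norm (E n t x - E n t y) \<le> norm (x - y)"
  using E_norm_le[of t n "x - y"] by (simp add: E_diff)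

lemma norm_yosida_le: "x \<in> D \<Longrightarrow> norm (yosida (\<omega> + real n) x) \<le> norm (A x)"
  using yosida_on_D[OF index_ge] norm_J_le[OF index_ge] by simp

lemma norm_yosidaE_le: "x \<in> D \<Longrightarrow> t \<ge> 0 \<Longrightarrow> norm (yosida (\<omega> + real n) (E n t x)) \<le> norm (A x)"
  using E_commute[OF bounded_linear_yosidan, of n n t x] E_norm_le[of t n "yosida (\<omega> + real n) x"] norm_yosida_le[of x n]
  by simp

text \<open>Two Yosida semigroups are compared by differentiating the squared distance. Replacing
  each orbit by its image under \<open>J\<close> makes the leading term dissipative, and the
  replacement error is the Yosida term over the parameter.\<close>

lemma E_cauchy_estimate:
  assumes x: "x \<in> D" and t: "t \<ge> 0"
  shows "(norm (E n t x - E m t x))\<^sup>2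
    \<le> 4 * (norm (A x))\<^sup>2 * (1 / (\<omega> + real n) + 1 / (\<omega> + real m)) * t"
proof -
  define M where "M = norm (A x)"
  let ?l = "\<omega> + real n" and ?m = "\<omega> + real m"
  have pos: "?l > 0" "?m > 0" using \<omega> by auto
  have "(norm (E n t x - E m t x))\<^sup>2
      \<le> (norm (E n 0 x - E m 0 x))\<^sup>2 + 2 * (2 * M\<^sup>2 * (1 / ?l + 1 / ?m)) * t"
  proof (rule energy_estimate[OF _ _ t])
    fix s :: real assume s: "s \<ge> 0"
    show "((\<lambda>s. E n s x - E m s x) has_vector_derivative
        yosida ?l (E n s x) - yosida ?m (E m s x)) (at s within {0..})"
      by (rule has_vector_derivative_at_within, rule has_vector_derivative_diff; rule E_deriv)
    define u v p q where uvpq: "u = E n s x" "v = E m s x" "p = yosida ?l u" "q = yosida ?m v"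
    have pq: "norm p \<le> M" "norm q \<le> M" using norm_yosidaE_le[OF x s] by (auto simp: uvpq M_def)
    \<comment> \<open>With this splitting \<open>p - q\<close> is \<open>A\<close> applied to
      \<open>J ?l u - J ?m v\<close>. The rest pairs a vector of norm at most
      \<open>M * (1 / ?l + 1 / ?m)\<close> with one of norm at most \<open>2 * M\<close>.\<close>
    have u: "u = J ?l u - (1 / ?l) *\<^sub>R p" and v: "v = J ?m v - (1 / ?m) *\<^sub>R q"
      using pos by (auto simp: uvpq yosida_def)
    have "inner (J ?l u - J ?m v) (p - q) \<le> 0"
      using dissipative A_diff[OF J_in_D[OF index_ge] J_in_D[OF index_ge], of n u m v]
        subspace_diff[OF subspace_D J_in_D[OF index_ge] J_in_D[OF index_ge], of n u m v]
      unfolding dissipative_on_def uvpq yosida_eq[OF index_ge] by metis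
    moreover have "inner ((1 / ?m) *\<^sub>R q - (1 / ?l) *\<^sub>R p) (p - q) \<le> (1 / ?m * M + 1 / ?l * M) * (M + M)"
    proof (rule order_trans[OF norm_cauchy_schwarz], intro mult_mono)
      show "norm ((1 / ?m) *\<^sub>R q - (1 / ?l) *\<^sub>R p) \<le> 1 / ?m * M + 1 / ?l * M"
        using pq pos by (intro norm_triangle_le_diff add_mono) (auto simp: divide_right_mono)
      show "norm (p - q) \<le> M + M" using pq by (intro norm_triangle_le_diff) simp
    qed (use pos in \<open>auto simp: M_def\<close>)
    moreover have "inner (u - v) (p - q)
        = inner (J ?l u - J ?m v) (p - q) + inner ((1 / ?m) *\<^sub>R q - (1 / ?l) *\<^sub>R p) (p - q)"
    proof -
      have "u - v = (J ?l u - J ?m v) + ((1 / ?m) *\<^sub>R q - (1 / ?l) *\<^sub>R p)"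
        by (subst u, subst v) (simp add: algebra_simps)
      then show ?thesis by (simp add: inner_add_left)
    qed
    ultimately have "inner (u - v) (p - q) \<le> 2 * M\<^sup>2 * (1 / ?l + 1 / ?m)"
      by (simp add: power2_eq_square algebra_simps)
    then show "inner (E n s x - E m s x) (yosida ?l (E n s x) - yosida ?m (E m s x)) \<le> 2 * M\<^sup>2 * (1 / ?l + 1 / ?m)"
      by (simp add: uvpq)
  qed
  then show ?thesis by (simp add: E_def M_def)
qed

lemma E_Cauchy_on_D:
  assumes x: "x \<in> D" and t: "t \<ge> 0"
  shows "Cauchy (\<lambda>n. E n t x)"
proof (rule metric_CauchyI)
  fix e :: real assume e: "e > 0"
  have "(\<lambda>N. 4 * (norm (A x))\<^sup>2 * (1 / (\<omega> + real N) + 1 / (\<omega> + real N)) * t) \<longlonglongrightarrow> 0"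
    by real_asymp
  then have "\<forall>\<^sub>F N in sequentially.
      4 * (norm (A x))\<^sup>2 * (1 / (\<omega> + real N) + 1 / (\<omega> + real N)) * t < e\<^sup>2"
    by (rule order_tendstoD) (use e in simp)
  then obtain N where N: "4 * (norm (A x))\<^sup>2 * (1 / (\<omega> + real N) + 1 / (\<omega> + real N)) * t < e\<^sup>2"
    unfolding eventually_sequentially by blast
  show "\<exists>N. \<forall>m\<ge>N. \<forall>n\<ge>N. dist (E m t x) (E n t x) < e"
  proof (intro exI allI impI)
    fix m n assume mn: "m \<ge> N" "n \<ge> N"
    have "(norm (E m t x - E n t x))\<^sup>2
        \<le> 4 * (norm (A x))\<^sup>2 * (1 / (\<omega> + real m) + 1 / (\<omega> + real n)) * t"
      by (rule E_cauchy_estimate[OF x t])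
    also have "\<dots> \<le> 4 * (norm (A x))\<^sup>2 * (1 / (\<omega> + real N) + 1 / (\<omega> + real N)) * t"
      using mn \<omega> t by (intro mult_right_mono mult_left_mono add_mono divide_left_mono) (auto simp: add_pos_nonneg)
    finally have "(norm (E m t x - E n t x))\<^sup>2 < e\<^sup>2" using N by simp
    then show "dist (E m t x) (E n t x) < e"
      using e by (simp add: dist_norm power_less_imp_less_base)
  qed
qed

lemma E_Cauchy:
  assumes t: "t \<ge> 0"
  shows "Cauchy (\<lambda>n. E n t x)"
proof (rule metric_CauchyI)
  fix e :: real assume e: "e > 0"
  obtain y where y: "y \<in> D" "dist y x < e / 3"
    using dense closure_approachable[of x D] e by (metis UNIV_I divide_pos_pos zero_less_numeral)
  obtain N where N: "\<And>m n. m \<ge> N \<Longrightarrow> n \<ge> N \<Longrightarrow> dist (E m t y) (E n t y) < e / 3"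
    using metric_CauchyD[OF E_Cauchy_on_D[OF y(1) t], of "e / 3"] e by auto
  have *: "dist (E m t x) (E m t y) < e / 3" for m
    using E_nonexpansive[OF t, of m x y] y(2) by (simp add: dist_norm norm_minus_commute)
  have "dist (E m t x) (E n t x) < e" if "m \<ge> N" "n \<ge> N" for m n
    using N[OF that] *[of m] *[of n] dist_triangle[of "E m t x" "E n t x" "E m t y"]
      dist_triangle[of "E m t y" "E n t x" "E n t y"] dist_commute[of "E n t x" "E n t y"] by linarith
  then show "\<exists>N. \<forall>m\<ge>N. \<forall>n\<ge>N. dist (E m t x) (E n t x) < e" by blast
qed

section \<open>The limit semigroup and its generator\<close>

definition T :: "real \<Rightarrow> 'a \<Rightarrow> 'a"
  where "T t x = lim (\<lambda>n. E n t x)"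

lemma T_lim: "t \<ge> 0 \<Longrightarrow> (\<lambda>n. E n t x) \<longlonglongrightarrow> T t x"
  unfolding T_def using E_Cauchy Cauchy_convergent convergent_LIMSEQ_iff by blast

lemma T_norm_le: "t \<ge> 0 \<Longrightarrow> norm (T t x) \<le> norm x"
  by (rule LIMSEQ_le_const2[OF tendsto_norm[OF T_lim]]) (auto simp: E_norm_le)

lemma T_0: "T 0 x = x"
  using T_lim[of 0 x] by (simp add: E_def LIMSEQ_const_iff)

lemma T_add: "t \<ge> 0 \<Longrightarrow> T t (x + y) = T t x + T t y"
  using tendsto_add[OF T_lim[of t x] T_lim[of t y]] T_lim[of t "x + y"]
  by (simp add: E_add LIMSEQ_unique)

text \<open>Commutation with \<open>A\<close> passes to the resolvents, the exponentials and their
  limit. The application that matters is multiplication by a complex scalar.\<close>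

lemma T_commute:
  assumes t: "t \<ge> 0" and S: "bounded_linear S" and SD: "\<And>x. x \<in> D \<Longrightarrow> S x \<in> D"
    and SA: "\<And>x. x \<in> D \<Longrightarrow> A (S x) = S (A x)"
  shows "T t (S x) = S (T t x)"
proof (rule LIMSEQ_unique[OF T_lim[OF t]])
  have "S (yosida (\<omega> + real n) x) = yosida (\<omega> + real n) (S x)" for n x
    using J_commute[OF index_ge S SD SA] bounded_linear.linear[OF S]
    by (simp add: yosida_def linear_scale linear_diff)
  then have "E n t (S x) = S (E n t x)" for n by (rule E_commute[OF S])
  then show "(\<lambda>n. E n t (S x)) \<longlonglongrightarrow> S (T t x)"
    using bounded_linear.tendsto[OF S T_lim[OF t]] by simp
qed

lemma T_scale: "t \<ge> 0 \<Longrightarrow> T t (c *\<^sub>R x) = c *\<^sub>R T t x"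
  by (rule T_commute) (auto intro: bounded_linear_scaleR_right simp: A_scale subspace_scale[OF subspace_D])

lemma T_diff: "t \<ge> 0 \<Longrightarrow> T t (x - y) = T t x - T t y"
  using T_add[of t "x - y" y] by simp

lemma T_semigroup:
  assumes t: "t \<ge> 0" and s: "s \<ge> 0"
  shows "T (t + s) x = T t (T s x)"
proof (rule LIMSEQ_unique[OF T_lim])
  have "norm (E n t (E n s x) - E n t (T s x)) \<le> norm (E n s x - T s x)" for n
    by (rule E_nonexpansive[OF t])
  moreover have "(\<lambda>n. norm (E n s x - T s x)) \<longlonglongrightarrow> 0"
    using T_lim[OF s] by (simp add: tendsto_norm_zero_iff LIM_zero_iff)
  ultimately have "(\<lambda>n. E n t (E n s x) - E n t (T s x)) \<longlonglongrightarrow> 0"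
    by (rule Lim_null_comparison[OF always_eventually[OF allI]])
  from tendsto_add[OF this T_lim[OF t, of "T s x"]]
  show "(\<lambda>n. E n (t + s) x) \<longlonglongrightarrow> T t (T s x)" by (simp add: E_semigroup[OF t])
qed (use t s in simp)

text \<open>The mean value inequality after subtracting the line of slope \<open>c\<close>. The
  slope is free: zero measures the displacement of an orbit, \<open>A x\<close> the error of its
  linearization.\<close>

lemma E_linearization:
  assumes h: "h \<ge> 0" and b: "\<And>s. 0 \<le> s \<Longrightarrow> s \<le> h \<Longrightarrow> norm (yosida (\<omega> + real n) (E n s x) - c) \<le> B"
  shows "norm (E n h x - x - h *\<^sub>R c) \<le> h * B"
proof -
  have "norm ((E n h x - h *\<^sub>R c) - (E n 0 x - 0 *\<^sub>R c)) \<le> B * norm (h - 0)"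
  proof (rule differentiable_bound[of "{0..h}" _ "\<lambda>s d. d *\<^sub>R (yosida (\<omega> + real n) (E n s x) - c)"])
    fix s assume s: "s \<in> {0..h}"
    have "((\<lambda>s. E n s x - s *\<^sub>R c) has_vector_derivative (yosida (\<omega> + real n) (E n s x) - c)) (at s)"
      by (rule derivative_eq_intros E_deriv refl)+ simp
    then show "((\<lambda>s. E n s x - s *\<^sub>R c) has_derivative (\<lambda>d. d *\<^sub>R (yosida (\<omega> + real n) (E n s x) - c)))
        (at s within {0..h})"
      unfolding has_vector_derivative_def by (rule has_derivative_at_withinI)
    show "onorm (\<lambda>d. d *\<^sub>R (yosida (\<omega> + real n) (E n s x) - c)) \<le> B"
      using b[of s] s by (intro onorm_le) (simp add: mult.commute[of B] mult_left_mono)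
  qed (use h in auto)
  then show ?thesis using h by (simp add: E_def algebra_simps)
qed

text \<open>A modulus of continuity uniform in \<open>n\<close> is available only for orbits
  starting in \<open>D\<close>, and \<open>A x\<close> may lie outside \<open>D\<close>. A nearby
  \<open>y\<close> in \<open>D\<close> takes its place, at the price of twice the distance.\<close>

lemma T_linearization:
  assumes x: "x \<in> D" and y: "y \<in> D" and h: "h \<ge> 0"
  shows "norm (T h x - x - h *\<^sub>R A x) \<le> h * (2 * norm (A x - y) + h * norm (A y))"
proof (rule LIMSEQ_le)
  have near: "norm (E n s y - y) \<le> s * norm (A y)" if "s \<ge> 0" for n s
    using E_linearization[OF that, of n y 0 "norm (A y)"] norm_yosidaE_le[OF y] by simp
  show "(\<lambda>n. norm (E n h x - x - h *\<^sub>R A x)) \<longlonglongrightarrow> norm (T h x - x - h *\<^sub>R A x)"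
    by (intro tendsto_intros T_lim h)
  show "(\<lambda>n. h * (norm (J (\<omega> + real n) (A x) - A x) + 2 * norm (A x - y) + h * norm (A y)))
      \<longlonglongrightarrow> h * (2 * norm (A x - y) + h * norm (A y))"
    by (rule tendsto_eq_intros J_tendsto refl)+ simp
  have "norm (E n h x - x - h *\<^sub>R A x)
      \<le> h * (norm (J (\<omega> + real n) (A x) - A x) + 2 * norm (A x - y) + h * norm (A y))" for n
  proof (rule E_linearization[OF h])
    fix s assume s: "0 \<le> s" "s \<le> h"
    have "yosida (\<omega> + real n) (E n s x) - A x
        = (E n s (J (\<omega> + real n) (A x)) - E n s (A x)) + (E n s (A x) - E n s y) + (E n s y - y) + (y - A x)"
      using E_commute[OF bounded_linear_yosidan, of n n s x] yosida_on_D[OF index_ge x, of n] by simp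
    also have "norm \<dots> \<le> norm (J (\<omega> + real n) (A x) - A x) + norm (A x - y) + h * norm (A y) + norm (y - A x)"
    proof -
      have "s * norm (A y) \<le> h * norm (A y)" using s by (simp add: mult_right_mono)
      then show ?thesis
        by (intro norm_triangle_mono E_nonexpansive s order_trans[OF near]) auto
    qed
    finally show "norm (yosida (\<omega> + real n) (E n s x) - A x)
        \<le> norm (J (\<omega> + real n) (A x) - A x) + 2 * norm (A x - y) + h * norm (A y)"
      by (simp add: norm_minus_commute)
  qed
  then show "\<exists>N. \<forall>n\<ge>N. norm (E n h x - x - h *\<^sub>R A x)
      \<le> h * (norm (J (\<omega> + real n) (A x) - A x) + 2 * norm (A x - y) + h * norm (A y))" by blast
qed

lemma T_generator_on_D:
  assumes x: "x \<in> D"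
  shows "((\<lambda>h. (1 / h) *\<^sub>R (T h x - x)) \<longlongrightarrow> A x) (at_right 0)"
proof (rule tendstoI)
  fix e :: real assume e: "e > 0"
  obtain y where y: "y \<in> D" "dist y (A x) < e / 4"
    using dense closure_approachable[of "A x" D] e by (metis UNIV_I divide_pos_pos zero_less_numeral)
  have "((\<lambda>h. h * norm (A y)) \<longlongrightarrow> 0) (at_right 0)" by (rule tendsto_eq_intros refl)+ simp
  then have "\<forall>\<^sub>F h in at_right 0. h * norm (A y) < e / 4" by (rule order_tendstoD) (use e in simp)
  moreover have "\<forall>\<^sub>F h in at_right (0::real). h > 0" by (rule eventually_at_right_less)
  ultimately show "\<forall>\<^sub>F h in at_right 0. dist ((1 / h) *\<^sub>R (T h x - x)) (A x) < e"
  proof eventually_elim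
    case (elim h)
    have "(1 / h) *\<^sub>R (T h x - x) - A x = (1 / h) *\<^sub>R (T h x - x - h *\<^sub>R A x)"
      using elim by (simp add: algebra_simps)
    then have "norm ((1 / h) *\<^sub>R (T h x - x) - A x) = norm (T h x - x - h *\<^sub>R A x) / h"
      using elim by simp
    also have "\<dots> \<le> 2 * norm (A x - y) + h * norm (A y)"
      using T_linearization[OF x y(1), of h] elim by (simp add: pos_divide_le_eq mult.commute)
    also have "\<dots> < e" using elim y(2) e by (simp add: dist_norm norm_minus_commute)
    finally show ?case by (simp add: dist_norm)
  qed
qed

lemma T_strongly_continuous: "((\<lambda>t. T t x) \<longlongrightarrow> x) (at_right 0)"
proof (rule nonexpansive_tendsto_on_dense[OF _ dense])
  have pos: "\<forall>\<^sub>F h in at_right (0::real). h > 0" by (rule eventually_at_right_less)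
  then show "\<forall>\<^sub>F t in at_right 0. \<forall>x y. dist (T t x) (T t y) \<le> dist x y"
    by eventually_elim (simp add: dist_norm T_diff[symmetric] T_norm_le)
  fix x assume x: "x \<in> D"
  have "((\<lambda>h. h *\<^sub>R ((1 / h) *\<^sub>R (T h x - x)) + x) \<longlongrightarrow> x) (at_right 0)"
    by (rule tendsto_eq_intros T_generator_on_D x refl)+ simp
  then show "((\<lambda>t. T t x) \<longlongrightarrow> x) (at_right 0)"
    by (rule Lim_transform_eventually)
      (use pos in \<open>eventually_elim, simp\<close>)
qed

text \<open>The generator of \<open>T\<close> extends \<open>A\<close>, and surjectivity of
  \<open>\<omega> - A\<close> leaves no room for a proper extension: the difference \<open>d\<close>
  of the two solutions would satisfy \<open>d' = \<omega> d\<close> at time zero, while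
  contractivity makes \<open>inner d (T h d - d)\<close> nonpositive.\<close>

lemma T_generator_domain:
  assumes lim: "((\<lambda>h. (1 / h) *\<^sub>R (T h x - x)) \<longlongrightarrow> y) (at_right 0)"
  shows "x \<in> D"
proof -
  obtain z where z: "z \<in> D" "\<omega> *\<^sub>R z - A z = \<omega> *\<^sub>R x - y" using range[of \<omega>] by auto
  define d where "d = x - z"
  have pos: "\<forall>\<^sub>F h in at_right (0::real). h > 0" by (rule eventually_at_right_less)
  have "((\<lambda>h. (1 / h) *\<^sub>R (T h x - x) - (1 / h) *\<^sub>R (T h z - z)) \<longlongrightarrow> y - A z) (at_right 0)"
    by (intro tendsto_diff lim T_generator_on_D z)
  then have "((\<lambda>h. (1 / h) *\<^sub>R (T h d - d)) \<longlongrightarrow> y - A z) (at_right 0)"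
    by (rule Lim_transform_eventually)
      (use pos in \<open>eventually_elim, simp add: d_def T_diff algebra_simps\<close>)
  moreover have "y - A z = \<omega> *\<^sub>R d" using z(2) by (simp add: d_def algebra_simps)
  ultimately have "((\<lambda>h. inner d ((1 / h) *\<^sub>R (T h d - d))) \<longlongrightarrow> inner d (\<omega> *\<^sub>R d)) (at_right 0)"
    using tendsto_inner[OF tendsto_const] by metis
  moreover have "\<forall>\<^sub>F h in at_right 0. inner d ((1 / h) *\<^sub>R (T h d - d)) \<le> 0"
    using pos
  proof eventually_elim
    case (elim h)
    have "inner d (T h d) \<le> norm d * norm d"
      by (rule order_trans[OF norm_cauchy_schwarz]) (use elim T_norm_le in \<open>auto intro: mult_left_mono\<close>)
    then show ?case using elim
      by (simp add: inner_diff_right dot_square_norm power2_eq_square divide_le_0_iff)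
  qed
  ultimately have "inner d (\<omega> *\<^sub>R d) \<le> 0"
    by (rule tendsto_upperbound) (simp add: trivial_limit_at_right_real)
  then have "inner d d = 0" using \<omega> inner_ge_zero[of d] by (simp add: mult_le_0_iff)
  then have "d = 0" by simp
  then show ?thesis using z by (simp add: d_def)
qed

end

theorem Lumer_Phillips:
  fixes A :: "'a::complex_hilbert \<Rightarrow> 'a"
  assumes A: "clinear_on D A" and dense: "closure D = UNIV" and diss: "dissipative_on D A"
    and range: "\<omega> > 0" "\<And>\<mu> y. \<mu> \<ge> \<omega> \<Longrightarrow> \<exists>x\<in>D. \<mu> *\<^sub>R x - A x = y"
  shows "generates_C0_semigroup (D, A)"
proof -
  interpret m_dissipative D A \<omega>
    by standard (use assms clinear_on_imp_real_linear_on in auto)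
  have scaleC: "T t (c *\<^sub>C x) = c *\<^sub>C T t x" if t: "t \<ge> 0" for t c x
  proof (rule T_commute[OF t])
    have "norm (c *\<^sub>C y) = norm y * cmod c" for y :: 'a
    proof -
      have "cinner (c *\<^sub>C y) (c *\<^sub>C y) = c * cnj (cinner y (c *\<^sub>C y))"
        by (simp only: cinner_scaleC_right cinner_commute[of "c *\<^sub>C y" y])
      also have "\<dots> = complex_of_real ((cmod c)\<^sup>2) * cinner y y"
        by (simp add: cinner_scaleC_right cinner_commute[of y y, symmetric] complex_norm_square del: of_real_power)
      finally have "inner (c *\<^sub>C y) (c *\<^sub>C y) = (cmod c)\<^sup>2 * inner y y"
        unfolding inner_eq_Re_cinner by (simp only: Re_complex_of_real times_complex.simps) simp
      then have "(norm (c *\<^sub>C y))\<^sup>2 = (norm y * cmod c)\<^sup>2"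
        by (simp add: power2_norm_eq_inner power_mult_distrib)
      then show ?thesis by simp
    qed
    then show "bounded_linear ((*\<^sub>C) c :: 'a \<Rightarrow> 'a)"
      by (intro bounded_linear_intro[where K = "cmod c"])
        (auto simp: scaleC_add_right scaleR_scaleC scaleC_scaleC mult.commute)
  qed (use assms(1) in \<open>auto simp: clinear_on_def csubspace_def\<close>)
  have "C0_semigroup T"
    unfolding C0_semigroup_def bounded_clinear_def clinear_on_def csubspace_def
    using T_0 T_semigroup T_strongly_continuous T_add scaleC T_norm_le
    by (auto intro!: exI[of _ "1::real"])
  then show ?thesis
    unfolding generates_C0_semigroup_def op_dom_def op_fun_def
    using T_generator_on_D T_generator_domain by (intro exI[of _ T]) auto
qed

subsection \<open>Strongly continuous semigroups and their generators\<close>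

lemma has_vector_derivative_imp_right_quotient:
  assumes "(f has_vector_derivative d) (at 0 within {0..b})" "b > 0"
  shows "((\<lambda>h. (1 / h) *\<^sub>R (f h - f 0)) \<longlongrightarrow> d) (at_right (0::real))"
proof -
  have "((\<lambda>h. (1 / norm h) *\<^sub>R (f h - (f 0 + h *\<^sub>R d))) \<longlongrightarrow> 0) (at_right 0)"
    using assms unfolding has_vector_derivative_def has_derivative_within
    by (simp add: at_within_Icc_at_right)
  then have "((\<lambda>h. (1 / h) *\<^sub>R (f h - f 0) - d) \<longlongrightarrow> 0) (at_right 0)"
  proof (rule Lim_transform_eventually)
    have "\<forall>\<^sub>F h in at_right (0::real). h > 0" by (rule eventually_at_right_less)
    then show "\<forall>\<^sub>F h in at_right 0. (1 / norm h) *\<^sub>R (f h - (f 0 + h *\<^sub>R d)) = (1 / h) *\<^sub>R (f h - f 0) - d"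
      by eventually_elim (simp add: algebra_simps)
  qed
  then show ?thesis by (simp add: LIM_zero_iff)
qed

locale semigroup_with_generator =
  fixes T :: "real \<Rightarrow> 'a::complex_hilbert \<Rightarrow> 'a" and D :: "'a set" and A :: "'a \<Rightarrow> 'a"
  assumes C0: "C0_semigroup T"
    and domain: "((\<lambda>h. (1 / h) *\<^sub>R (T h x - x)) \<longlongrightarrow> y) (at_right 0) \<Longrightarrow> x \<in> D"
    and generator: "x \<in> D \<Longrightarrow> ((\<lambda>h. (1 / h) *\<^sub>R (T h x - x)) \<longlongrightarrow> A x) (at_right 0)"

lemma generates_C0_semigroupE:
  assumes "generates_C0_semigroup (D, A)"
  obtains T where "semigroup_with_generator T D A"
proof -
  obtain T where "C0_semigroup T"
    "D = {x. \<exists>y. ((\<lambda>h. (1 / h) *\<^sub>R (T h x - x)) \<longlongrightarrow> y) (at_right 0)}"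
    "\<forall>x\<in>D. ((\<lambda>h. (1 / h) *\<^sub>R (T h x - x)) \<longlongrightarrow> A x) (at_right 0)"
    using assms unfolding generates_C0_semigroup_def op_dom_def op_fun_def by auto
  then have "semigroup_with_generator T D A"
    unfolding semigroup_with_generator_def by blast
  then show thesis by (rule that)
qed

context semigroup_with_generator
begin

section \<open>Bounds and regularity of orbits\<close>

lemma T_bounded_linear: "t \<ge> 0 \<Longrightarrow> bounded_linear (T t)"
  using C0 by (simp add: C0_semigroup_def bounded_clinear_imp_bounded_linear)

lemma T_0: "T 0 x = x"
  and T_semigroup: "s \<ge> 0 \<Longrightarrow> t \<ge> 0 \<Longrightarrow> T (s + t) x = T s (T t x)"
  and T_right_continuous: "((\<lambda>t. T t x) \<longlongrightarrow> x) (at_right 0)"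
  using C0 by (simp_all add: C0_semigroup_def)

lemmas T_linear = bounded_linear.linear[OF T_bounded_linear]
lemmas T_diff = linear_diff[OF T_linear] and T_scale = linear_scale[OF T_linear]

lemma generator_unique:
  assumes "((\<lambda>h. (1 / h) *\<^sub>R (T h x - x)) \<longlongrightarrow> y) (at_right 0)"
  shows "x \<in> D" "A x = y"
  using domain[OF assms] tendsto_unique[OF trivial_limit_at_right_real generator assms] by auto

lemma T_near_identity:
  assumes "e > 0"
  obtains d where "d > 0" "\<And>h. 0 \<le> h \<Longrightarrow> h < d \<Longrightarrow> norm (T h x - x) < e"
proof -
  have "\<forall>\<^sub>F h in at_right 0. dist (T h x) x < e" using T_right_continuous assms by (rule tendstoD)
  then obtain d where d: "d > 0" "\<And>h. 0 < h \<Longrightarrow> h < d \<Longrightarrow> dist (T h x) x < e"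
    unfolding eventually_at_right_field by auto
  have "norm (T h x - x) < e" if "0 \<le> h" "h < d" for h
    using d(2)[of h] that assms by (cases "h = 0") (auto simp: T_0 dist_norm)
  then show thesis using that d by blast
qed

text \<open>Uniform boundedness near zero by Baire's theorem, from mere right continuity of each
  orbit at zero.\<close>

lemma T_local_bound:
  obtains M d where "M \<ge> 1" "d > 0" "\<And>t x. 0 \<le> t \<Longrightarrow> t \<le> d \<Longrightarrow> norm (T t x) \<le> M * norm x"
proof -
  \<comment> \<open>The single index \<open>k\<close> both shortens the time interval and raises the
    bound, so each \<open>x\<close> is caught once \<open>k\<close> is large for its own
    orbit.\<close>
  define F where "F k = (\<Inter>t\<in>{0..1 / real (Suc k)}. {x. norm (T t x) \<le> real k})" for k
  have "closed (F k)" for k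
    unfolding F_def
    by (intro closed_INT ballI closed_Collect_le continuous_intros
      bounded_linear.continuous_on[OF T_bounded_linear]) auto
  moreover have "(UNIV :: 'a set) \<subseteq> (\<Union>k. F k)"
  proof
    fix x :: 'a
    obtain d where d: "d > 0" "\<And>h. 0 \<le> h \<Longrightarrow> h < d \<Longrightarrow> norm (T h x - x) < 1"
      using T_near_identity[of 1 x] by auto
    obtain k1 where k1: "1 + norm x \<le> real k1" using real_arch_simple by blast
    obtain k2 where k2: "inverse (real (Suc k2)) < d" using reals_Archimedean[OF d(1)] by blast
    define k where "k = max k1 k2"
    have "x \<in> F k"
      unfolding F_def
    proof (rule INT_I, rule CollectI)
      fix t assume t: "t \<in> {0..1 / real (Suc k)}"
      have "1 / real (Suc k) \<le> inverse (real (Suc k2))"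
        unfolding inverse_eq_divide by (rule divide_left_mono) (auto simp: k_def)
      then have "norm (T t x - x) < 1" using d(2)[of t] t k2 by auto
      then have "norm (T t x) \<le> 1 + norm x" using norm_triangle_ineq2[of "T t x" x] by simp
      then show "norm (T t x) \<le> real k" using k1 by (simp add: k_def)
    qed
    then show "x \<in> (\<Union>k. F k)" by blast
  qed
  ultimately obtain k x r where x: "r > 0" "ball x r \<subseteq> F k"
    using Baire_ball[of "UNIV :: 'a set" F] by (metis Int_UNIV_right UNIV_not_empty closed_UNIV)
  have small: "norm (T t y) \<le> 2 * real k" if "norm y < r" "0 \<le> t" "t \<le> 1 / real (Suc k)" for y t
  proof -
    have "x + y \<in> F k" "x \<in> F k" using that x by (auto simp: dist_norm)
    then have "norm (T t (x + y)) \<le> real k" "norm (T t x) \<le> real k" using that by (auto simp: F_def)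
    moreover have "T t y = T t (x + y) - T t x" using T_diff[OF that(2), of "x + y" x] by simp
    ultimately show ?thesis using norm_triangle_ineq4[of "T t (x + y)" "T t x"] by simp
  qed
  define M where "M = 1 + 4 * real k / r"
  have "norm (T t y) \<le> M * norm y" if t: "0 \<le> t" "t \<le> 1 / real (Suc k)" for y t
  proof (cases "y = 0")
    case True then show ?thesis using linear_0[OF T_linear[OF t(1)]] by simp
  next
    case False
    define c where "c = r / (2 * norm y)"
    have c: "c > 0" using False x by (simp add: c_def)
    have "norm (c *\<^sub>R y) < r" using False x c by (simp add: c_def)
    then have "norm (T t (c *\<^sub>R y)) \<le> 2 * real k" by (rule small[OF _ t])
    then have "norm (T t y) \<le> 2 * real k / c"
      using c by (simp add: T_scale[OF t(1)] pos_le_divide_eq mult.commute)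
    also have "\<dots> \<le> M * norm y" using x False by (simp add: c_def M_def field_simps)
    finally show ?thesis .
  qed
  then show thesis using that[of M "1 / real (Suc k)"] x by (simp add: M_def)
qed

lemma T_bound:
  obtains M where "M \<ge> 1" "\<And>t x. 0 \<le> t \<Longrightarrow> t \<le> N \<Longrightarrow> norm (T t x) \<le> M * norm x"
proof -
  obtain M d where M: "M \<ge> 1" "d > 0" "\<And>t x. 0 \<le> t \<Longrightarrow> t \<le> d \<Longrightarrow> norm (T t x) \<le> M * norm x"
    by (rule T_local_bound) blast
  have *: "norm (T t x) \<le> M ^ Suc n * norm x" if "0 \<le> t" "t \<le> real (Suc n) * d" for n t x
    using that
  proof (induction n arbitrary: t)
    case (Suc n)
    show ?case
    proof (cases "t \<le> d")
      case True
      have "norm (T t x) \<le> M * norm x" using M(3) Suc.prems True by blast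
      also have "\<dots> \<le> M ^ Suc (Suc n) * norm x"
        using M(1) by (intro mult_right_mono self_le_power) auto
      finally show ?thesis .
    next
      case False
      have "norm (T t x) = norm (T d (T (t - d) x))" using T_semigroup[of d "t - d" x] False M(2) by simp
      also have "\<dots> \<le> M * norm (T (t - d) x)" using M by simp
      also have "\<dots> \<le> M * (M ^ Suc n * norm x)"
        using Suc False M(1) by (intro mult_left_mono Suc.IH) (auto simp: algebra_simps)
      finally show ?thesis by (simp add: mult.assoc)
    qed
  qed (use M in simp)
  obtain n where "N / d \<le> real n" using real_arch_simple by blast
  then have n: "N \<le> real (Suc n) * d" using M(2) by (simp add: field_simps)
  show thesis using that[of "M ^ Suc n"] * n M(1) one_le_power[OF M(1)] by (meson order_trans)
qed

lemma T_continuous_on: "continuous_on {0..} (\<lambda>t. T t x)"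
  unfolding continuous_on_iff
proof (intro ballI allI impI)
  fix t e :: real assume t: "t \<in> {0..}" and e: "e > 0"
  obtain M where M: "M \<ge> 1" "\<And>s x. 0 \<le> s \<Longrightarrow> s \<le> t + 1 \<Longrightarrow> norm (T s x) \<le> M * norm x"
    using T_bound[of "t + 1"] by blast
  obtain d where d: "d > 0" "\<And>h. 0 \<le> h \<Longrightarrow> h < d \<Longrightarrow> norm (T h x - x) < e / M"
    using T_near_identity[of "e / M" x] e M(1) by auto
  \<comment> \<open>Factoring out \<open>T\<close> at the earlier of the two times treats left and
    right continuity by the same estimate.\<close>
  have key: "norm (T b x - T a x) < e" if ab: "0 \<le> a" "a \<le> b" "a \<le> t + 1" "b - a < d" for a b
  proof -
    have "T b x - T a x = T a (T (b - a) x - x)"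
      using T_semigroup[of a "b - a" x] ab by (simp add: T_diff)
    also have "norm \<dots> \<le> M * norm (T (b - a) x - x)" using M(2) ab by simp
    also have "\<dots> < M * (e / M)" using d(2)[of "b - a"] ab M(1) by (intro mult_strict_left_mono) auto
    finally show ?thesis using M(1) by simp
  qed
  show "\<exists>d>0. \<forall>s\<in>{0..}. dist s t < d \<longrightarrow> dist (T s x) (T t x) < e"
  proof (intro exI[of _ d] conjI ballI impI)
    fix s :: real assume s: "s \<in> {0..}" "dist s t < d"
    show "dist (T s x) (T t x) < e"
    proof (cases "s \<le> t")
      case True then show ?thesis
        using key[of s t] s by (auto simp: dist_norm norm_minus_commute abs_if split: if_splits)
    next
      case False then show ?thesis
        using key[of t s] s t by (auto simp: dist_norm abs_if split: if_splits)
    qed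
  qed (use d in auto)
qed

lemma T_invariant:
  assumes x: "x \<in> D" and t: "t \<ge> 0"
  shows T_in_D: "T t x \<in> D" and A_T: "A (T t x) = T t (A x)"
proof -
  have "((\<lambda>h. T t ((1 / h) *\<^sub>R (T h x - x))) \<longlongrightarrow> T t (A x)) (at_right 0)"
    by (rule bounded_linear.tendsto[OF T_bounded_linear[OF t] generator[OF x]])
  then have "((\<lambda>h. (1 / h) *\<^sub>R (T h (T t x) - T t x)) \<longlongrightarrow> T t (A x)) (at_right 0)"
  proof (rule Lim_transform_eventually)
    have "\<forall>\<^sub>F h in at_right (0::real). h > 0" by (rule eventually_at_right_less)
    then show "\<forall>\<^sub>F h in at_right 0. T t ((1 / h) *\<^sub>R (T h x - x)) = (1 / h) *\<^sub>R (T h (T t x) - T t x)"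
    proof eventually_elim
      case (elim h)
      then show ?case using T_semigroup[of h t x] T_semigroup[of t h x] t
        by (simp add: T_scale T_diff add.commute)
    qed
  qed
  then show "T t x \<in> D" "A (T t x) = T t (A x)" by (rule generator_unique)+
qed

text \<open>The generator gives right derivatives at zero only. For left quotients too,
  \<open>T\<close> is factored out at the earlier time \<open>a\<close>, and continuity of the orbit
  of \<open>A x\<close> replaces \<open>T a (A x)\<close> by \<open>T t (A x)\<close>.\<close>

lemma T_has_vector_derivative:
  assumes x: "x \<in> D" and t: "t \<ge> 0"
  shows "((\<lambda>s. T s x) has_vector_derivative T t (A x)) (at t within {0..})"
  unfolding has_vector_derivative_def has_derivative_within_alt
proof (intro conjI allI impI)
  fix e :: real assume e: "e > 0"
  obtain M where M: "M \<ge> 1" "\<And>s x. 0 \<le> s \<Longrightarrow> s \<le> t \<Longrightarrow> norm (T s x) \<le> M * norm x"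
    using T_bound[of "t"] by blast
  have "\<forall>\<^sub>F h in at_right 0. dist ((1 / h) *\<^sub>R (T h x - x)) (A x) < e / (2 * M)"
    using generator[OF x] e M(1) by (intro tendstoD) auto
  then obtain d1 where d1: "d1 > 0"
    "\<And>h. 0 < h \<Longrightarrow> h < d1 \<Longrightarrow> dist ((1 / h) *\<^sub>R (T h x - x)) (A x) < e / (2 * M)"
    unfolding eventually_at_right_field by auto
  have "e / 2 > 0" using e by simp
  then obtain d2 where d2: "d2 > 0"
    "\<And>s. s \<ge> 0 \<Longrightarrow> dist s t < d2 \<Longrightarrow> dist (T s (A x)) (T t (A x)) < e / 2"
    using T_continuous_on[of "A x"] t unfolding continuous_on_iff by (metis atLeast_iff)
  have key: "norm (T b x - T a x - (b - a) *\<^sub>R T t (A x)) \<le> e * (b - a)"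
    if ab: "0 \<le> a" "a \<le> t" "a < b" "b - a < d1" "t - a < d2" for a b
  proof -
    define h where "h = b - a"
    have h: "h > 0" "h < d1" using ab by (auto simp: h_def)
    have Tb: "T b x = T a (T h x)" using T_semigroup[of a h x] ab by (simp add: h_def)
    have "T b x - T a x - h *\<^sub>R T t (A x)
        = h *\<^sub>R (T a ((1 / h) *\<^sub>R (T h x - x) - A x) + (T a (A x) - T t (A x)))"
      using h by (simp add: Tb T_diff T_scale ab(1) scaleR_add_right scaleR_diff_right)
    also have "norm \<dots> = h * norm (T a ((1 / h) *\<^sub>R (T h x - x) - A x) + (T a (A x) - T t (A x)))"
      using h by simp
    also have "\<dots> \<le> h * (e / 2 + e / 2)"
    proof (intro mult_left_mono norm_triangle_mono)
      have "norm (T a ((1 / h) *\<^sub>R (T h x - x) - A x)) \<le> M * norm ((1 / h) *\<^sub>R (T h x - x) - A x)"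
        using M(2) ab by blast
      also have "\<dots> \<le> M * (e / (2 * M))"
        using d1(2)[OF h] M(1) by (intro mult_left_mono) (auto simp: dist_norm)
      finally show "norm (T a ((1 / h) *\<^sub>R (T h x - x) - A x)) \<le> e / 2" using M(1) by simp
      show "norm (T a (A x) - T t (A x)) \<le> e / 2"
        using d2(2)[of a] ab by (simp add: dist_norm)
    qed (use h in simp)
    finally show ?thesis by (simp add: h_def mult.commute)
  qed
  show "\<exists>d>0. \<forall>y\<in>{0..}. norm (y - t) < d \<longrightarrow>
      norm (T y x - T t x - (y - t) *\<^sub>R T t (A x)) \<le> e * norm (y - t)"
  proof (intro exI[of _ "min d1 d2"] conjI ballI impI)
    fix y assume y: "y \<in> {0..}" "norm (y - t) < min d1 d2"
    consider "y = t" | "y < t" | "t < y" by linarith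
    then show "norm (T y x - T t x - (y - t) *\<^sub>R T t (A x)) \<le> e * norm (y - t)"
    proof cases
      case 2
      have "norm (T y x - T t x - (y - t) *\<^sub>R T t (A x))
          = norm (T t x - T y x - (t - y) *\<^sub>R T t (A x))"
        by (subst norm_minus_cancel[symmetric]) (simp add: algebra_simps)
      then show ?thesis using key[of y t] y 2 by simp
    next
      case 3 then show ?thesis using key[of t y] y t d2(1) by auto
    qed simp
  qed (use d1 d2 in auto)
qed (intro bounded_linear_scaleR_left)

text \<open>The linearization error with slope \<open>m\<close> depends on \<open>A (x n)\<close>
  only through \<open>M * norm (A (x n) - m)\<close>. It therefore survives the limit and exhibits
  \<open>m\<close> as the right derivative of the orbit of \<open>l\<close>.\<close>

lemma generator_closed: "closed_op (D, A)"
  unfolding closed_op_iff_sequentially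
proof (intro allI impI, elim conjE)
  fix x l m assume xD: "\<forall>n. x n \<in> D" and xl: "x \<longlonglongrightarrow> l" and xm: "(\<lambda>n. A (x n)) \<longlonglongrightarrow> m"
  obtain M where M: "M \<ge> 1" "\<And>s x. 0 \<le> s \<Longrightarrow> s \<le> 1 \<Longrightarrow> norm (T s x) \<le> M * norm x"
    using T_bound[of 1] by blast
  have est: "norm (T h l - l - h *\<^sub>R m) \<le> h * e"
    if h: "0 \<le> h" "h \<le> 1" and e: "\<And>s. 0 \<le> s \<Longrightarrow> s \<le> h \<Longrightarrow> norm (T s m - m) \<le> e" for h e
  proof (rule LIMSEQ_le)
    show "(\<lambda>n. norm (T h (x n) - x n - h *\<^sub>R m)) \<longlonglongrightarrow> norm (T h l - l - h *\<^sub>R m)"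
      by (intro tendsto_intros bounded_linear.tendsto[OF T_bounded_linear] h xl)
    show "(\<lambda>n. h * (M * norm (A (x n) - m) + e)) \<longlonglongrightarrow> h * e"
      by (rule tendsto_eq_intros xm refl)+ simp
    have "norm (T h (x n) - x n - h *\<^sub>R m) \<le> h * (M * norm (A (x n) - m) + e)" for n
    proof -
      have "norm ((T h (x n) - h *\<^sub>R m) - (T 0 (x n) - 0 *\<^sub>R m))
          \<le> (M * norm (A (x n) - m) + e) * norm (h - 0)"
      proof (rule differentiable_bound[of "{0..h}" _ "\<lambda>s d. d *\<^sub>R (T s (A (x n)) - m)"])
        fix s assume s: "s \<in> {0..h}"
        have "((\<lambda>s. T s (x n) - s *\<^sub>R m) has_vector_derivative (T s (A (x n)) - m)) (at s within {0..})"
          using s has_vector_derivative_scaleR[OF DERIV_ident has_vector_derivative_const[of m]]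
          by (intro has_vector_derivative_diff T_has_vector_derivative xD[rule_format]) auto
        then have "((\<lambda>s. T s (x n) - s *\<^sub>R m) has_vector_derivative (T s (A (x n)) - m)) (at s within {0..h})"
          by (rule has_vector_derivative_within_subset) auto
        then show "((\<lambda>s. T s (x n) - s *\<^sub>R m) has_derivative (\<lambda>d. d *\<^sub>R (T s (A (x n)) - m)))
            (at s within {0..h})"
          by (simp add: has_vector_derivative_def)
        have "norm (T s (A (x n)) - m) = norm (T s (A (x n) - m) + (T s m - m))"
          using s by (simp add: T_diff)
        also have "\<dots> \<le> M * norm (A (x n) - m) + e"
          using s h M(2)[of s] e[of s] by (intro norm_triangle_mono) auto
        finally show "onorm (\<lambda>d. d *\<^sub>R (T s (A (x n)) - m)) \<le> M * norm (A (x n) - m) + e"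
          by (intro onorm_le)
            (simp add: mult.commute[of "M * norm (A (x n) - m) + e"] mult_left_mono)
      qed (use h in auto)
      then show ?thesis using h by (simp add: T_0 algebra_simps)
    qed
    then show "\<exists>N. \<forall>n\<ge>N. norm (T h (x n) - x n - h *\<^sub>R m) \<le> h * (M * norm (A (x n) - m) + e)" by blast
  qed
  have "((\<lambda>h. (1 / h) *\<^sub>R (T h l - l)) \<longlongrightarrow> m) (at_right 0)"
  proof (rule tendstoI)
    fix e :: real assume e: "e > 0"
    obtain d where d: "d > 0" "\<And>h. 0 \<le> h \<Longrightarrow> h < d \<Longrightarrow> norm (T h m - m) < e / 2"
      using T_near_identity[of "e / 2" m] e by auto
    have "dist ((1 / h) *\<^sub>R (T h l - l)) m < e" if h: "0 < h" "h < min d 1" for h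
    proof -
      have "norm (T h l - l - h *\<^sub>R m) \<le> h * (e / 2)"
        using h d(2) by (intro est) (auto intro: less_imp_le)
      moreover have "(1 / h) *\<^sub>R (T h l - l) - m = (1 / h) *\<^sub>R (T h l - l - h *\<^sub>R m)"
        using h by (simp add: algebra_simps)
      ultimately have "norm ((1 / h) *\<^sub>R (T h l - l) - m) \<le> e / 2"
        using h by (simp add: pos_divide_le_eq mult.commute)
      then show ?thesis using e by (simp add: dist_norm)
    qed
    then show "\<forall>\<^sub>F h in at_right 0. dist ((1 / h) *\<^sub>R (T h l - l)) m < e"
      unfolding eventually_at_right_field using d(1) by (intro exI[of _ "min d 1"]) auto
  qed
  then show "l \<in> D \<and> A l = m" using generator_unique by blast
qed

section \<open>Contractivity and resolvents of a dissipative generator\<close>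

lemma T_contraction:
  assumes diss: "dissipative_on D A" and dense: "closure D = UNIV" and t: "t \<ge> 0"
  shows "norm (T t x) \<le> norm x"
proof -
  have D: "norm (T t x) \<le> norm x" if x: "x \<in> D" for x
  proof -
    have "(norm (T t x))\<^sup>2 \<le> (norm (T 0 x))\<^sup>2 + 2 * 0 * t"
    proof (rule energy_estimate[OF T_has_vector_derivative[OF x] _ t])
      fix s :: real assume s: "s \<ge> 0"
      then show "inner (T s x) (T s (A x)) \<le> 0"
        using diss T_in_D[OF x s] A_T[OF x s] unfolding dissipative_on_def by metis
    qed
    then show ?thesis by (simp add: T_0 power2_le_iff_abs_le)
  qed
  obtain y where y: "\<And>n. y n \<in> D" "y \<longlonglongrightarrow> x"
    using dense closure_sequential[of x D] by auto
  show ?thesis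
    by (rule LIMSEQ_le[OF tendsto_norm[OF bounded_linear.tendsto[OF T_bounded_linear[OF t] y(2)]]
      tendsto_norm[OF y(2)]]) (use D y in blast)
qed

text \<open>A finite horizon avoids improper integrals: the range of \<open>\<mu> - A\<close> is dense by letting
  \<open>N \<rightarrow> \<infinity>\<close>, and closed by dissipativity.\<close>

lemma truncated_resolvent:
  assumes N: "N \<ge> 0"
  obtains x where "x \<in> D" "\<mu> *\<^sub>R x - A x = y - exp (- \<mu> * N) *\<^sub>R T N y"
proof -
  define f where "f t = exp (- \<mu> * t) *\<^sub>R T t y" for t
  \<comment> \<open>The Laplace integral that represents the resolvent, cut off at finite
    time.\<close>
  define F where "F t = integral {0..t} f" for t
  have cf: "continuous_on {0..} f"
    unfolding f_def by (intro continuous_intros T_continuous_on)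
  have cfi: "continuous_on {a..b} f" if "a \<ge> 0" for a b
    by (rule continuous_on_subset[OF cf]) (use that in auto)
  have Ff: "(F has_vector_derivative f t) (at t within {0..N + 1})" if "t \<in> {0..N + 1}" for t
    unfolding F_def by (rule integral_has_vector_derivative[OF cfi that]) simp
  \<comment> \<open>Applying \<open>T h\<close> shifts the integrand by \<open>h\<close> and costs
    the factor \<open>exp (\<mu> * h)\<close>; \<open>g\<close> thus writes the orbit of
    \<open>F N\<close> through the differentiable function \<open>F\<close>.\<close>
  define g where "g h = exp (\<mu> * h) *\<^sub>R (F (N + h) - F h)" for h
  have TF: "T h (F N) = g h" if h: "h \<ge> 0" for h
  proof -
    have "T h (F N) = integral {0..N} (T h \<circ> f)"
      unfolding F_def
      by (rule integral_linear[symmetric, OF integrable_continuous_real[OF cfi] T_bounded_linear[OF h]]) simp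
    also have "\<dots> = integral {0..N} (\<lambda>t. exp (\<mu> * h) *\<^sub>R (f \<circ> (+) h) t)"
    proof (rule Henstock_Kurzweil_Integration.integral_cong)
      fix t assume t: "t \<in> {0..N}"
      have "exp (\<mu> * h) * exp (- \<mu> * (t + h)) = exp (- \<mu> * t)"
        by (simp add: mult_exp_exp algebra_simps)
      then show "(T h \<circ> f) t = exp (\<mu> * h) *\<^sub>R (f \<circ> (+) h) t"
        using T_semigroup[of h t y] t h by (simp add: f_def T_scale add.commute)
    qed
    also have "\<dots> = exp (\<mu> * h) *\<^sub>R integral {0 + h..N + h} f"
      using integral_shift_Icc_real[of 0 N f h] by (simp add: o_def)
    also have "integral {0 + h..N + h} f = F (N + h) - F h"
      using Henstock_Kurzweil_Integration.integral_combine[of 0 h "N + h" f]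
        integrable_continuous_real[OF cfi, of 0 "N + h"] N h
      by (simp add: F_def algebra_simps)
    finally show ?thesis by (simp add: g_def)
  qed
  have F0: "F 0 = 0" by (simp add: F_def)
  have "((\<lambda>h. F (N + h)) has_vector_derivative f N) (at 0 within {0..1})"
  proof -
    have "((\<lambda>h. N + h) has_vector_derivative 1) (at 0 within {0..1})"
      by (auto intro!: derivative_eq_intros)
    moreover have "(F has_vector_derivative f N) (at (N + 0) within (\<lambda>h. N + h) ` {0..1})"
      by (rule has_vector_derivative_within_subset[of _ _ _ "{0..N + 1}"]) (use Ff[of N] N in auto)
    ultimately show ?thesis
      using vector_diff_chain_within[of "\<lambda>h. N + h" 1 0 "{0..1}" F "f N"] by (simp add: o_def)
  qed
  moreover have "(F has_vector_derivative f 0) (at 0 within {0..1})"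
    by (rule has_vector_derivative_within_subset[OF Ff]) (use N in auto)
  ultimately have FF: "((\<lambda>h. F (N + h) - F h) has_vector_derivative f N - f 0) (at 0 within {0..1})"
    by (rule has_vector_derivative_diff)
  have ee: "((\<lambda>h. exp (\<mu> * h)) has_real_derivative \<mu>) (at 0 within {0..1})"
    by (auto intro!: derivative_eq_intros)
  have "(g has_vector_derivative f N - f 0 + \<mu> *\<^sub>R F N) (at 0 within {0..1})"
    unfolding g_def using has_vector_derivative_scaleR[OF ee FF] by (simp add: F0)
  then have "((\<lambda>h. (1 / h) *\<^sub>R (g h - g 0)) \<longlongrightarrow> f N - f 0 + \<mu> *\<^sub>R F N) (at_right 0)"
    by (rule has_vector_derivative_imp_right_quotient) simp
  then have "((\<lambda>h. (1 / h) *\<^sub>R (T h (F N) - F N)) \<longlongrightarrow> f N - f 0 + \<mu> *\<^sub>R F N) (at_right 0)"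
  proof (rule Lim_transform_eventually)
    have "\<forall>\<^sub>F h in at_right (0::real). h > 0" by (rule eventually_at_right_less)
    then show "\<forall>\<^sub>F h in at_right 0. (1 / h) *\<^sub>R (g h - g 0) = (1 / h) *\<^sub>R (T h (F N) - F N)"
      by eventually_elim (simp add: TF, simp add: g_def F0)
  qed
  then have "F N \<in> D" "A (F N) = f N - f 0 + \<mu> *\<^sub>R F N" by (rule generator_unique)+
  then show thesis using that[of "F N"] by (simp add: f_def T_0)
qed

lemma resolvent_surjective:
  assumes A: "real_linear_on D A" and diss: "dissipative_on D A" and dense: "closure D = UNIV"
    and \<mu>: "\<mu> > 0"
  shows "\<exists>x\<in>D. \<mu> *\<^sub>R x - A x = y"
proof -
  define r where "r n = y - exp (- \<mu> * real n) *\<^sub>R T (real n) y" for n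
  have "\<exists>x\<in>D. \<mu> *\<^sub>R x - A x = r n" for n
    using truncated_resolvent[of "real n" \<mu> y] unfolding r_def by (metis of_nat_0_le_iff)
  then obtain x where x: "\<And>n. x n \<in> D" "\<And>n. \<mu> *\<^sub>R x n - A (x n) = r n" by metis
  have "(\<lambda>n. norm y * exp (- \<mu> * real n)) \<longlonglongrightarrow> 0" using \<mu> by real_asymp
  moreover have "norm (r n - y) \<le> norm y * exp (- \<mu> * real n)" for n
    using T_contraction[OF diss dense, of "real n" y] by (simp add: r_def mult.commute)
  ultimately have "(\<lambda>n. r n - y) \<longlonglongrightarrow> 0"
    by (rule Lim_null_comparison[OF always_eventually[OF allI], rotated])
  then have r: "r \<longlonglongrightarrow> y" by (simp add: LIM_zero_iff)
  have lip: "norm (x n - x m) \<le> norm (r n - r m) / \<mu>" for n m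
  proof -
    have "\<mu> *\<^sub>R (x n - x m) - A (x n - x m) = r n - r m"
      using x real_linear_on_diff[OF A] by (simp add: algebra_simps flip: x(2))
    then have "\<mu> * norm (x n - x m) \<le> norm (r n - r m)"
      using dissipative_on_norm_le(1)[OF diss, of "x n - x m" \<mu>] \<mu> x
        subspace_diff[OF real_linear_on_subspace[OF A]] by simp
    then show ?thesis using \<mu> by (simp add: pos_le_divide_eq mult.commute)
  qed
  have "Cauchy x"
  proof (rule metric_CauchyI)
    fix e :: real assume e: "e > 0"
    then obtain N where "\<And>m n. m \<ge> N \<Longrightarrow> n \<ge> N \<Longrightarrow> dist (r m) (r n) < e * \<mu>"
      using metric_CauchyD[OF LIMSEQ_imp_Cauchy[OF r], of "e * \<mu>"] \<mu> by auto
    then have "dist (x m) (x n) < e" if "m \<ge> N" "n \<ge> N" for m n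
      using lip[of m n] that \<mu> by (smt (verit) dist_norm pos_divide_less_eq)
    then show "\<exists>N. \<forall>m\<ge>N. \<forall>n\<ge>N. dist (x m) (x n) < e" by blast
  qed
  then obtain l where l: "x \<longlonglongrightarrow> l" using Cauchy_convergent convergent_def by blast
  have "A (x n) = \<mu> *\<^sub>R x n - r n" for n using x(2)[of n] by (simp add: algebra_simps)
  then have "(\<lambda>n. A (x n)) \<longlonglongrightarrow> \<mu> *\<^sub>R l - y" by (simp add: tendsto_intros l r)
  from closed_opD[OF generator_closed x(1) l this] show ?thesis
    by (intro bexI[of _ l]) auto
qed

end

subsection \<open>The dissipation inequality of a scattering passive node\<close>

lemma node_ker_subset: "node_ker Z G \<subseteq> Z"
  by (auto simp: node_ker_def)

lemma csubspace_node_ker: "clinear_on Z G \<Longrightarrow> csubspace (node_ker Z G)"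
  using real_linear_on_zero[OF clinear_on_imp_real_linear_on, of Z G]
  unfolding clinear_on_def csubspace_def node_ker_def
  by (auto simp: scaleR_scaleC[of 0, symmetric]) (metis scaleC_add_right add_cancel_right_right)

lemma clinear_on_subset: "clinear_on S f \<Longrightarrow> csubspace T \<Longrightarrow> T \<subseteq> S \<Longrightarrow> clinear_on T f"
  unfolding clinear_on_def by blast

lemma clinear_on_plus: "clinear_on S f \<Longrightarrow> clinear_on S g \<Longrightarrow> clinear_on S (\<lambda>x. f x + g x)"
  unfolding clinear_on_def by (auto simp: scaleC_add_right)

lemma internally_wellposed_nodeD:
  assumes "internally_wellposed_node Z G L K"
  shows "real_linear_on Z G" "real_linear_on Z L" "real_linear_on Z K"
    and "closed_op (Z, \<lambda>z. (G z, L z, K z))" "\<And>u. \<exists>z\<in>Z. G z = u"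
    and "closure (node_ker Z G) = UNIV" "generates_C0_semigroup (node_ker Z G, L)"
    and "real_linear_on (node_ker Z G) L"
proof -
  show ker: "real_linear_on (node_ker Z G) L"
    using assms unfolding internally_wellposed_node_def
    by (meson clinear_on_imp_real_linear_on clinear_on_subset csubspace_node_ker node_ker_subset)
  show "\<exists>z\<in>Z. G z = u" for u
    using assms unfolding internally_wellposed_node_def by (metis UNIV_I imageE)
qed (use assms in \<open>auto simp: internally_wellposed_node_def semigroup_generator_def
    clinear_on_imp_real_linear_on\<close>)

locale wellposed_node_semigroup = semigroup_with_generator T "node_ker Z G" L
  for T :: "real \<Rightarrow> 'x::complex_hilbert \<Rightarrow> 'x" and Z and G :: "'x \<Rightarrow> 'u::complex_hilbert" and L +
  fixes K :: "'x \<Rightarrow> 'y::complex_hilbert"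
  assumes wp: "internally_wellposed_node Z G L K"
begin

lemmas G = internally_wellposed_nodeD(1)[OF wp]
  and L = internally_wellposed_nodeD(2)[OF wp]
  and K = internally_wellposed_nodeD(3)[OF wp]
  and node_closed = internally_wellposed_nodeD(4)[OF wp]
  and L_ker = internally_wellposed_nodeD(8)[OF wp]

text \<open>On the graph of the closed generator, a Banach space, closedness of the node gives
  \<open>K\<close> a closed graph. The bound makes \<open>K\<close> continuous along orbits in
  \<open>ker G\<close>, as continuity in the graph norm demands.\<close>

lemma K_relatively_bounded:
  obtains C where "C > 0" "\<And>z. z \<in> node_ker Z G \<Longrightarrow> norm (K z) \<le> C * (norm z + norm (L z))"
proof -
  let ?S = "(\<lambda>z. (z, L z)) ` node_ker Z G"
  have K_ker: "real_linear_on (node_ker Z G) K"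
    by (rule real_linear_on_subset[OF K real_linear_on_subspace[OF L_ker] node_ker_subset])
  note sub = real_linear_on_subspace[OF L_ker]
  obtain C where C: "C > 0" "\<And>p. p \<in> ?S \<Longrightarrow> norm (K (fst p)) \<le> C * norm p"
  proof (rule closed_graph[of ?S "\<lambda>p. K (fst p)"])
    have "?S = {(x, op_fun (node_ker Z G, L) x) | x. x \<in> op_dom (node_ker Z G, L)}"
      by (auto simp: op_fun_def op_dom_def)
    then show "closed ?S" using generator_closed by (simp add: closed_op_def)
    have "subspace ?S"
    proof (rule subspaceI)
      show "0 \<in> ?S"
        using subspace_0[OF sub] real_linear_on_zero[OF L_ker] by (auto simp: zero_prod_def)
      show "p + q \<in> ?S" if "p \<in> ?S" "q \<in> ?S" for p q
      proof -
        from that obtain x y where "p = (x, L x)" "q = (y, L y)" "x \<in> node_ker Z G" "y \<in> node_ker Z G"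
          by auto
        then show ?thesis
          using real_linear_on_add[OF L_ker, of x y] subspace_add[OF sub, of x y] by auto
      qed
      show "c *\<^sub>R p \<in> ?S" if "p \<in> ?S" for c p
      proof -
        from that obtain x where "p = (x, L x)" "x \<in> node_ker Z G" by auto
        then show ?thesis
          using real_linear_on_scale[OF L_ker, of x c] subspace_scale[OF sub, of x c] by auto
      qed
    qed
    then show "real_linear_on ?S (\<lambda>p. K (fst p))"
      using real_linear_on_add[OF K_ker] real_linear_on_scale[OF K_ker]
      by (auto simp: real_linear_on_def)
    show "closed_op (?S, \<lambda>p. K (fst p))"
      unfolding closed_op_iff_sequentially
    proof (intro allI impI, elim conjE)
      fix p l k assume p: "\<forall>n. p n \<in> ?S" "p \<longlonglongrightarrow> l" "(\<lambda>n. K (fst (p n))) \<longlonglongrightarrow> k"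
      define z where "z n = fst (p n)" for n
      have pn: "p n = (z n, L (z n))" "z n \<in> node_ker Z G" for n
        using p(1)[rule_format, of n] by (auto simp: z_def)
      have zl: "z \<longlonglongrightarrow> fst l" "(\<lambda>n. L (z n)) \<longlonglongrightarrow> snd l"
        using tendsto_fst[OF p(2)] tendsto_snd[OF p(2)] by (simp_all add: pn)
      have "fst l \<in> node_ker Z G" "L (fst l) = snd l"
        by (rule closed_opD[OF generator_closed pn(2) zl])+
      moreover have "(G (fst l), L (fst l), K (fst l)) = (0, snd l, k)"
        by (rule closed_opD(2)[OF node_closed _ zl(1)])
          (use pn p(3) zl in \<open>auto simp: node_ker_def intro!: tendsto_Pair\<close>)
      ultimately show "l \<in> ?S \<and> K (fst l) = k"
        by (auto intro!: image_eqI[of _ _ "fst l"] simp: prod_eq_iff)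
    qed
  qed blast
  show thesis
  proof (rule that[OF C(1)])
    fix z assume z: "z \<in> node_ker Z G"
    have "norm (K z) \<le> C * norm (z, L z)" using C(2)[of "(z, L z)"] z by auto
    also have "\<dots> \<le> C * (norm z + norm (L z))"
      using C(1) norm_Pair_le[of z "L z"] by (intro mult_left_mono) auto
    finally show "norm (K z) \<le> C * (norm z + norm (L z))" .
  qed
qed

text \<open>Only these explicit trajectories, with input \<open>exp t *\<^sub>R G w\<close>, are needed to test passivity.\<close>

lemma smooth_solution_exp:
  assumes w: "w \<in> Z" "L w = w" and v: "v \<in> node_ker Z G"
  shows "smooth_solution Z G L K (\<lambda>t. exp t *\<^sub>R G w) (\<lambda>t. exp t *\<^sub>R w + T t v)"
proof -
  note sub = real_linear_on_subspace[OF L]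
  let ?u = "\<lambda>t. exp t *\<^sub>R G w" and ?z = "\<lambda>t. exp t *\<^sub>R w + T t v"
  have exp_deriv: "((\<lambda>t. exp t *\<^sub>R a) has_vector_derivative exp t *\<^sub>R a) (at t within {0..})"
    for a :: "'c::real_normed_vector" and t :: real
    using has_vector_derivative_scaleR[OF DERIV_exp[THEN has_field_derivative_at_within] has_vector_derivative_const[of a]]
    by simp
  have C2: "C2_halfline ?u"
    unfolding C2_halfline_def
    by (rule exI[of _ ?u], rule exI[of _ ?u]) (auto intro: exp_deriv intro!: continuous_intros)
  have Tv: "T t v \<in> Z" "G (T t v) = 0" "L (T t v) = T t (L v)" if "t \<ge> 0" for t
    using T_in_D[OF v that] A_T[OF v that] by (auto simp: node_ker_def)
  have zZ: "?z t \<in> Z" and Gz: "G (?z t) = ?u t" and Lz: "L (?z t) = exp t *\<^sub>R w + T t (L v)"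
    and Kz: "K (?z t) = exp t *\<^sub>R K w + K (T t v)" if t: "t \<ge> 0" for t
    using Tv[OF t] w subspace_add[OF sub] subspace_scale[OF sub, of w "exp t"]
      real_linear_on_add[OF G] real_linear_on_scale[OF G w(1)]
      real_linear_on_add[OF L] real_linear_on_scale[OF L w(1)]
      real_linear_on_add[OF K] real_linear_on_scale[OF K w(1)] by auto
  have deriv: "(?z has_vector_derivative L (?z t)) (at t within {0..})" if t: "t \<ge> 0" for t
    unfolding Lz[OF t] by (intro has_vector_derivative_add exp_deriv T_has_vector_derivative v t)
  have Lcont: "continuous_on {0..} (\<lambda>t. L (?z t))"
  proof (rule continuous_on_eq)
    show "continuous_on {0..} (\<lambda>t. exp t *\<^sub>R w + T t (L v))"
      by (intro continuous_intros T_continuous_on)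
  qed (simp add: Lz)
  obtain C where C: "C > 0" "\<And>z. z \<in> node_ker Z G \<Longrightarrow> norm (K z) \<le> C * (norm z + norm (L z))"
    by (rule K_relatively_bounded) blast
  have graph: "((\<lambda>s. graph_norm G L K (?z s - ?z t)) \<longlongrightarrow> 0) (at t within {0..})" if t: "t \<ge> 0" for t
  proof -
    have Tlim: "((\<lambda>s. T s x) \<longlongrightarrow> T t x) (at t within {0..})" for x
      using T_continuous_on[of x] t unfolding continuous_on_def by auto
    have KTlim: "((\<lambda>s. K (T s v)) \<longlongrightarrow> K (T t v)) (at t within {0..})"
    proof (rule LIM_zero_cancel, rule Lim_null_comparison)
      show "((\<lambda>s. C * (norm (T s v - T t v) + norm (T s (L v) - T t (L v)))) \<longlongrightarrow> 0) (at t within {0..})"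
        by (rule tendsto_eq_intros Tlim refl)+ simp
      have "norm (K (T s v) - K (T t v)) \<le> C * (norm (T s v - T t v) + norm (T s (L v) - T t (L v)))"
        if s: "s \<ge> 0" for s
        using C(2)[OF subspace_diff[OF real_linear_on_subspace[OF L_ker] T_in_D[OF v s] T_in_D[OF v t]]]
          Tv[OF s] Tv[OF t] by (simp add: real_linear_on_diff[OF K] real_linear_on_diff[OF L])
      then show "\<forall>\<^sub>F s in at t within {0..}. norm (K (T s v) - K (T t v))
          \<le> C * (norm (T s v - T t v) + norm (T s (L v) - T t (L v)))"
        by (auto simp: eventually_at_filter)
    qed
    have elim: "((\<lambda>s. exp s *\<^sub>R a) \<longlongrightarrow> exp t *\<^sub>R a) (at t within {0..})" for a :: "'c::real_normed_vector"
      by (intro tendsto_intros)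
    have "((\<lambda>s. sqrt ((norm (?z s - ?z t))\<^sup>2
        + (norm ((exp s *\<^sub>R w + T s (L v)) - (exp t *\<^sub>R w + T t (L v))))\<^sup>2
        + (norm (?u s - ?u t))\<^sup>2
        + (norm ((exp s *\<^sub>R K w + K (T s v)) - (exp t *\<^sub>R K w + K (T t v))))\<^sup>2)) \<longlongrightarrow> 0) (at t within {0..})"
      by (rule tendsto_eq_intros Tlim KTlim elim refl)+ simp
    then show ?thesis
    proof (rule Lim_transform_eventually)
      have "sqrt ((norm (?z s - ?z t))\<^sup>2
        + (norm ((exp s *\<^sub>R w + T s (L v)) - (exp t *\<^sub>R w + T t (L v))))\<^sup>2
        + (norm (?u s - ?u t))\<^sup>2
        + (norm ((exp s *\<^sub>R K w + K (T s v)) - (exp t *\<^sub>R K w + K (T t v))))\<^sup>2)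
        = graph_norm G L K (?z s - ?z t)" if s: "s \<ge> 0" for s
        unfolding graph_norm_def
        using real_linear_on_diff[OF G zZ[OF s] zZ[OF t]] real_linear_on_diff[OF L zZ[OF s] zZ[OF t]]
          real_linear_on_diff[OF K zZ[OF s] zZ[OF t]]
        by (simp only: Gz Lz Kz s t)
      then show "\<forall>\<^sub>F s in at t within {0..}. sqrt ((norm (?z s - ?z t))\<^sup>2
        + (norm ((exp s *\<^sub>R w + T s (L v)) - (exp t *\<^sub>R w + T t (L v))))\<^sup>2
        + (norm (?u s - ?u t))\<^sup>2
        + (norm ((exp s *\<^sub>R K w + K (T s v)) - (exp t *\<^sub>R K w + K (T t v))))\<^sup>2)
        = graph_norm G L K (?z s - ?z t)"
        unfolding eventually_at_filter by (intro always_eventually) simp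
    qed
  qed
  show ?thesis
    unfolding smooth_solution_def using C2 zZ Gz deriv graph Lcont by blast
qed

lemma dissipation_inequality_at_sum:
  assumes passivity: "scattering_passive_node Z G L K"
    and w: "w \<in> Z" "L w = w" and v: "v \<in> node_ker Z G"
  shows "2 * inner (w + v) (L (w + v)) + (norm (K (w + v)))\<^sup>2 \<le> (norm (G w))\<^sup>2"
proof -
  let ?z = "\<lambda>t. exp t *\<^sub>R w + T t v"
  have sol: "smooth_solution Z G L K (\<lambda>t. exp t *\<^sub>R G w) ?z"
    by (rule smooth_solution_exp[OF w v])
  then obtain d where d: "((\<lambda>s. (norm (?z s))\<^sup>2) has_real_derivative d) (at 0 within {0..})"
    "d + (norm (K (?z 0)))\<^sup>2 \<le> (norm (exp 0 *\<^sub>R G w))\<^sup>2"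
    using passivity order_refl[of "0::real"] unfolding scattering_passive_node_def by blast
  have "(?z has_vector_derivative L (?z 0)) (at 0 within {0..})"
    using sol unfolding smooth_solution_def by blast
  from has_real_derivative_norm_power2[OF this]
  have "((\<lambda>s. (norm (?z s))\<^sup>2) has_real_derivative 2 * inner (w + v) (L (w + v))) (at 0 within {0..})"
    by (simp add: T_0)
  \<comment> \<open>Passivity provides some derivative of the energy; uniqueness of the one-sided
    derivative at zero identifies it.\<close>
  then have "d = 2 * inner (w + v) (L (w + v))"
    using d(1) vector_derivative_unique_within[of 0 "{0..}"] trivial_limit_at_right_real[of "0::real"]
    unfolding has_real_derivative_iff_has_vector_derivative by (metis at_within_Ici_at_right)
  then show ?thesis using d(2) by (simp add: T_0)
qed

end

text \<open>The choice \<open>w = 0\<close> in the dissipation inequality makes the generator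
  dissipative; its semigroup then gives surjectivity for every positive parameter.\<close>

lemma scattering_passive_resolvent:
  assumes passivity: "scattering_passive_node Z G L K"
  shows scattering_passive_dissipative: "dissipative_on (node_ker Z G) L"
    and scattering_passive_surjective: "\<mu> > 0 \<Longrightarrow> \<exists>x\<in>node_ker Z G. \<mu> *\<^sub>R x - L x = y"
proof -
  have wp: "internally_wellposed_node Z G L K"
    using passivity by (simp add: scattering_passive_node_def)
  obtain T where "semigroup_with_generator T (node_ker Z G) L"
    using generates_C0_semigroupE[OF internally_wellposed_nodeD(7)[OF wp]] .
  then interpret wellposed_node_semigroup T Z G L K
    by (simp add: wellposed_node_semigroup_def wellposed_node_semigroup_axioms_def wp)
  show diss: "dissipative_on (node_ker Z G) L"
    unfolding dissipative_on_def
  proof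
    fix v assume "v \<in> node_ker Z G"
    then have "2 * inner v (L v) + (norm (K v))\<^sup>2 \<le> 0"
      using dissipation_inequality_at_sum[OF passivity, of 0 v] subspace_0[OF real_linear_on_subspace[OF L]]
        real_linear_on_zero[OF L] real_linear_on_zero[OF G] by simp
    then show "inner v (L v) \<le> 0" using zero_le_power2[of "norm (K v)"] by linarith
  qed
  show "\<mu> > 0 \<Longrightarrow> \<exists>x\<in>node_ker Z G. \<mu> *\<^sub>R x - L x = y"
    by (rule resolvent_surjective[OF L_ker diss internally_wellposed_nodeD(6)[OF wp]])
qed

lemma scattering_passive_decompose:
  assumes passivity: "scattering_passive_node Z G L K" and z: "z \<in> Z"
  obtains w v where "w \<in> Z" "L w = w" "v \<in> node_ker Z G" "z = w + v" "G w = G z"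
proof -
  have wp: "internally_wellposed_node Z G L K"
    using passivity by (simp add: scattering_passive_node_def)
  note G = internally_wellposed_nodeD(1)[OF wp] and L = internally_wellposed_nodeD(2)[OF wp]
  obtain v where v: "v \<in> node_ker Z G" "v - L v = z - L z"
    using scattering_passive_surjective[OF passivity, of 1 "z - L z"] by auto
  then have vZ: "v \<in> Z" "G v = 0" by (auto simp: node_ker_def)
  show thesis
  proof (rule that[of "z - v" v])
    show "z - v \<in> Z" using subspace_diff[OF real_linear_on_subspace[OF L]] z vZ by simp
    show "L (z - v) = z - v"
    proof -
      have "L z = z - (v - L v)" by (simp add: v(2))
      then show ?thesis using real_linear_on_diff[OF L z vZ(1)] by simp
    qed
    show "G (z - v) = G z" using real_linear_on_diff[OF G z vZ(1)] vZ by simp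
  qed (use v in auto)
qed

lemma scattering_passive_inequality:
  assumes passivity: "scattering_passive_node Z G L K" and z: "z \<in> Z"
  shows "2 * inner z (L z) + (norm (K z))\<^sup>2 \<le> (norm (G z))\<^sup>2"
proof -
  have wp: "internally_wellposed_node Z G L K"
    using passivity by (simp add: scattering_passive_node_def)
  obtain T where "semigroup_with_generator T (node_ker Z G) L"
    using generates_C0_semigroupE[OF internally_wellposed_nodeD(7)[OF wp]] .
  then interpret wellposed_node_semigroup T Z G L K
    by (simp add: wellposed_node_semigroup_def wellposed_node_semigroup_axioms_def wp)
  obtain w v where "w \<in> Z" "L w = w" "v \<in> node_ker Z G" "z = w + v" "G w = G z"
    by (rule scattering_passive_decompose[OF passivity z])
  then show ?thesis using dissipation_inequality_at_sum[OF passivity, of w v] by simp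
qed

text \<open>Along a given smooth solution the derivative of the energy is
  \<open>2 * inner (z t) (L (z t))\<close>, so the static inequality applies at each time
  separately.\<close>

lemma scattering_passive_nodeI:
  assumes wp: "internally_wellposed_node Z G L K"
    and ineq: "\<And>z. z \<in> Z \<Longrightarrow> 2 * inner z (L z) + (norm (K z))\<^sup>2 \<le> (norm (G z))\<^sup>2"
  shows "scattering_passive_node Z G L K"
  unfolding scattering_passive_node_def
proof (intro conjI wp allI impI)
  fix u z t assume sol: "smooth_solution Z G L K u z" and t: "(0::real) \<le> t"
  then have zt: "z t \<in> Z" "G (z t) = u t" "(z has_vector_derivative L (z t)) (at t within {0..})"
    unfolding smooth_solution_def by auto
  show "\<exists>D. ((\<lambda>s. (norm (z s))\<^sup>2) has_real_derivative D) (at t within {0..}) \<and>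
      D + (norm (K (z t)))\<^sup>2 \<le> (norm (u t))\<^sup>2"
    using has_real_derivative_norm_power2[OF zt(3)] ineq[OF zt(1)] zt(2) by auto
qed

subsection \<open>Relatively bounded perturbations\<close>

text \<open>In a Hilbert space \<open>\<parallel>A x\<parallel> \<le> \<parallel>\<mu> x - A x\<parallel>\<close> for dissipative \<open>A\<close>, so any relative bound
  \<open>b < 1\<close> makes \<open>H (\<mu> - A)\<^sup>-\<^sup>1\<close> a strict contraction for large \<open>\<mu>\<close>.\<close>

lemma relatively_bounded_perturbation_surjective:
  fixes A H :: "'a::{real_inner,complete_space} \<Rightarrow> 'a"
  assumes A: "real_linear_on D A" "dissipative_on D A" and H: "real_linear_on D H"
    and surj: "\<And>y. \<exists>x\<in>D. \<mu> *\<^sub>R x - A x = y"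
    and rel: "\<And>x. x \<in> D \<Longrightarrow> norm (H x) \<le> a * norm x + b * norm (A x)"
    and ab: "0 \<le> a" "0 \<le> b" and \<mu>: "\<mu> > 0" "a / \<mu> + b < 1"
  shows "\<exists>x\<in>D. \<mu> *\<^sub>R x - (A x + H x) = y"
proof -
  obtain R where R: "\<And>y. R y \<in> D" "\<And>y. \<mu> *\<^sub>R R y - A (R y) = y" using surj by metis
  note sub = real_linear_on_subspace[OF A(1)]
  have "dist (y + H (R u)) (y + H (R v)) \<le> (a / \<mu> + b) * dist u v" for u v
  proof -
    define d where "d = R u - R v"
    have d: "d \<in> D" using R subspace_diff[OF sub] by (simp add: d_def)
    have "\<mu> *\<^sub>R d - A d = (\<mu> *\<^sub>R R u - A (R u)) - (\<mu> *\<^sub>R R v - A (R v))"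
      using real_linear_on_diff[OF A(1) R(1) R(1)] by (simp add: d_def algebra_simps)
    then have res: "\<mu> *\<^sub>R d - A d = u - v" by (simp add: R)
    have le: "\<mu> * norm d \<le> norm (u - v)" "norm (A d) \<le> norm (u - v)"
      using dissipative_on_norm_le[OF A(2) d, of \<mu>] \<mu> by (simp_all add: res)
    have "dist (y + H (R u)) (y + H (R v)) = norm (H d)"
      using real_linear_on_diff[OF H R(1) R(1)] by (simp add: d_def dist_norm)
    also have "\<dots> \<le> a * norm d + b * norm (A d)" by (rule rel[OF d])
    also have "\<dots> \<le> a * (norm (u - v) / \<mu>) + b * norm (u - v)"
      using le \<mu> ab by (intro add_mono mult_left_mono) (auto simp: pos_le_divide_eq mult.commute)
    finally show ?thesis by (simp add: dist_norm algebra_simps)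
  qed
  \<comment> \<open>With \<open>R\<close> the resolvent of \<open>A\<close>, the unknown
    \<open>w = \<mu> x - A x\<close> turns the perturbed equation into
    \<open>w = y + H (R w)\<close>.\<close>
  then obtain w where w: "y + H (R w) = w"
    using banach_fix_type[of "a / \<mu> + b" "\<lambda>w. y + H (R w)"] ab \<mu> by auto
  then have "\<mu> *\<^sub>R R w - (A (R w) + H (R w)) = y"
    using R(2)[of w] by (simp add: algebra_simps)
  then show ?thesis using R by blast
qed

locale perturbed_passive_node =
  fixes Z :: "'x::complex_hilbert set" and G :: "'x \<Rightarrow> 'u::complex_hilbert" and L H :: "'x \<Rightarrow> 'x"
    and K :: "'x \<Rightarrow> 'y::complex_hilbert" and a b :: real
  assumes passivity: "scattering_passive_node Z G L K"
    and H_clinear: "clinear_on Z H" and H_dissipative: "dissipative_on Z H"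
    and ab: "a > 0" "0 \<le> b" "b < 1"
    and rel: "\<And>z. z \<in> node_ker Z G \<Longrightarrow> norm (H z) \<le> a * norm z + b * norm (L z)"
begin

lemma wp: "internally_wellposed_node Z G L K"
  using passivity by (simp add: scattering_passive_node_def)

lemmas G = internally_wellposed_nodeD(1)[OF wp]
  and L = internally_wellposed_nodeD(2)[OF wp]
  and node_closed = internally_wellposed_nodeD(4)[OF wp]
  and dense_ker = internally_wellposed_nodeD(6)[OF wp]
  and L_ker = internally_wellposed_nodeD(8)[OF wp]
  and H = clinear_on_imp_real_linear_on[OF H_clinear]

lemmas subspace_Z = real_linear_on_subspace[OF L]

lemma dense_Z: "closure Z = UNIV"
  using closure_mono[OF node_ker_subset] dense_ker by (metis top.extremum_uniqueI)

lemma generates: "generates_C0_semigroup (node_ker Z G, \<lambda>z. L z + H z)"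
proof (rule Lumer_Phillips)
  have cl: "clinear_on Z G" "clinear_on Z L" using wp by (auto simp: internally_wellposed_node_def)
  show "clinear_on (node_ker Z G) (\<lambda>z. L z + H z)"
    by (rule clinear_on_subset[OF clinear_on_plus[OF cl(2) H_clinear] csubspace_node_ker[OF cl(1)]
      node_ker_subset])
  show "dissipative_on (node_ker Z G) (\<lambda>z. L z + H z)"
    using scattering_passive_dissipative[OF passivity] H_dissipative node_ker_subset[of Z G]
    unfolding dissipative_on_def by (fastforce simp: inner_add_right)
  \<comment> \<open>From this threshold on \<open>a / \<mu>\<close> is at most half of the gap
    \<open>1 - b\<close>, which keeps the contraction constant strictly below one.\<close>
  show "2 * a / (1 - b) > 0" using ab by simp
  fix \<mu> y assume m: "\<mu> \<ge> 2 * a / (1 - b)"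
  have m0: "\<mu> > 0" using m ab by (smt (verit) divide_pos_pos)
  have "2 * a \<le> \<mu> * (1 - b)" using m ab by (simp add: pos_divide_le_eq)
  then have "a / \<mu> \<le> (1 - b) / 2" using m0 by (simp add: field_simps)
  also have "\<dots> < 1 - b" using ab by simp
  finally have "a / \<mu> + b < 1" by simp
  then show "\<exists>x\<in>node_ker Z G. \<mu> *\<^sub>R x - (L x + H x) = y"
    using ab m0
    by (intro relatively_bounded_perturbation_surjective[OF L_ker scattering_passive_dissipative[OF passivity]
        real_linear_on_subset[OF H real_linear_on_subspace[OF L_ker] node_ker_subset]
        scattering_passive_surjective[OF passivity m0] rel])
      auto
qed (rule dense_ker)

text \<open>This gives both injectivity of \<open>G\<close> on \<open>ker (1 - L)\<close> and
  continuity of its inverse.\<close>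

lemma eigenvector_norm_le:
  assumes w: "w \<in> Z" "L w = w" shows "norm w \<le> norm (G w)"
proof -
  have "2 * (norm w)\<^sup>2 + (norm (K w))\<^sup>2 \<le> (norm (G w))\<^sup>2"
    using scattering_passive_inequality[OF passivity w(1)] w(2) by (simp add: dot_square_norm)
  then have "(norm w)\<^sup>2 \<le> (norm (G w))\<^sup>2"
    using zero_le_power2[of "norm w"] zero_le_power2[of "norm (K w)"] by linarith
  then show ?thesis by (simp add: power2_le_iff_abs_le)
qed

text \<open>The map \<open>G w \<mapsto> H w\<close> on \<open>ker (1 - L)\<close> is defined on all of the input space, and its graph is
  closed because \<open>H\<close> is closable.\<close>

lemma H_bounded_on_eigenvectors:
  obtains C where "C > 0" "\<And>w. w \<in> Z \<Longrightarrow> L w = w \<Longrightarrow> norm (H w) \<le> C * norm (G w)"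
proof -
  have "\<exists>w\<in>Z. L w = w \<and> G w = u" for u
  proof -
    obtain z where "z \<in> Z" "G z = u" using internally_wellposed_nodeD(5)[OF wp] by blast
    then show ?thesis using scattering_passive_decompose[OF passivity] by metis
  qed
  \<comment> \<open>\<open>R\<close> is the right inverse of \<open>G\<close> with values in
    \<open>ker (1 - L)\<close>; the uniqueness shown next makes it linear.\<close>
  then obtain R where R: "\<And>u. R u \<in> Z" "\<And>u. L (R u) = R u" "\<And>u. G (R u) = u" by metis
  have unique: "w = R u" if w: "w \<in> Z" "L w = w" "G w = u" for w u
  proof -
    have "w - R u \<in> Z" "L (w - R u) = w - R u" "G (w - R u) = 0"
      using w R subspace_diff[OF subspace_Z] real_linear_on_diff[OF L w(1) R(1)]
        real_linear_on_diff[OF G w(1) R(1)] by auto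
    then show ?thesis using eigenvector_norm_le[of "w - R u"] by simp
  qed
  have R_add: "R (u + v) = R u + R v" for u v
    by (rule unique[symmetric])
      (simp_all add: R subspace_add[OF subspace_Z] real_linear_on_add[OF L] real_linear_on_add[OF G])
  have R_scale: "R (c *\<^sub>R u) = c *\<^sub>R R u" for c u
    by (rule unique[symmetric])
      (simp_all add: R subspace_scale[OF subspace_Z] real_linear_on_scale[OF L] real_linear_on_scale[OF G])
  have lin: "real_linear_on UNIV (\<lambda>u. H (R u))"
    unfolding real_linear_on_def
    by (simp add: R_add R_scale R(1) real_linear_on_add[OF H] real_linear_on_scale[OF H])
  obtain C where C: "C > 0" "\<And>u. u \<in> UNIV \<Longrightarrow> norm (H (R u)) \<le> C * norm u"
  proof (rule closed_graph[OF closed_UNIV lin])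
    show "closed_op (UNIV, \<lambda>u. H (R u))"
      unfolding closed_op_iff_sequentially
    proof (intro allI impI, elim conjE)
      fix u l h assume u: "u \<longlonglongrightarrow> l" "(\<lambda>n. H (R (u n))) \<longlonglongrightarrow> h"
      have "norm (R (u n - l)) \<le> norm (u n - l)" for n
        using eigenvector_norm_le[OF R(1) R(2), of "u n - l"] by (simp add: R(3))
      then have "(\<lambda>n. R (u n - l)) \<longlonglongrightarrow> 0"
        using tendsto_norm_zero[OF LIM_zero[OF u(1)]]
        by (rule Lim_null_comparison[OF always_eventually[OF allI]])
      moreover have "H (R (u n - l)) = H (R (u n)) - H (R l)" for n
        using real_linear_on_diff[OF lin, of "u n" l] by simp
      then have "(\<lambda>n. H (R (u n - l))) \<longlonglongrightarrow> h - H (R l)"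
        by (simp add: tendsto_intros u(2))
      ultimately have "h - H (R l) = 0"
        by (rule densely_defined_dissipative_closable[OF H dense_Z H_dissipative R(1)])
      then show "l \<in> UNIV \<and> H (R l) = h" by simp
    qed
  qed blast
  show thesis
  proof (rule that[OF C(1)])
    fix w assume "w \<in> Z" "L w = w"
    then have "R (G w) = w" using unique by metis
    then show "norm (H w) \<le> C * norm (G w)" using C(2)[of "G w"] by simp
  qed
qed

lemma L_bounded_by_perturbation:
  obtains M where "\<And>z. z \<in> Z \<Longrightarrow> norm (L z) \<le> M * (norm z + norm (G z) + norm (L z + H z))"
proof -
  obtain C where C: "C > 0" "\<And>w. w \<in> Z \<Longrightarrow> L w = w \<Longrightarrow> norm (H w) \<le> C * norm (G w)"
    by (rule H_bounded_on_eigenvectors) blast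
  \<comment> \<open>The bound on \<open>H v\<close> contains \<open>b * norm (L v)\<close>, which is
    absorbed on the left and leaves the divisor \<open>1 - b\<close>. The leading 1 pays for
    \<open>w\<close> in \<open>L z = w + L v\<close>.\<close>
  define M where "M = 1 + (1 + C + a) / (1 - b)"
  have "norm (L z) \<le> M * (norm z + norm (G z) + norm (L z + H z))" if z: "z \<in> Z" for z
  proof -
    obtain w v where wv: "w \<in> Z" "L w = w" "v \<in> node_ker Z G" "z = w + v" "G w = G z"
      by (rule scattering_passive_decompose[OF passivity z])
    have vZ: "v \<in> Z" using wv(3) by (simp add: node_ker_def)
    define g p where "g = norm (G z)" and "p = norm (L z + H z)"
    have w: "norm w \<le> g" "norm (H w) \<le> C * g"
      using eigenvector_norm_le[OF wv(1,2)] C(2)[OF wv(1,2)] wv(5) by (simp_all add: g_def)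
    have Lz: "L z = w + L v" and Hz: "H z = H w + H v"
      using real_linear_on_add[OF L wv(1) vZ] real_linear_on_add[OF H wv(1) vZ] wv by auto
    have "L v = (L z + H z) - w - H w - H v" by (simp add: Lz Hz)
    then have "norm (L v) \<le> p + norm w + norm (H w) + norm (H v)"
      unfolding p_def by (metis norm_triangle_le_diff add_right_mono order_refl)
    moreover have "norm v \<le> norm z + norm w" using wv(4) norm_triangle_ineq4[of z w] by simp
    ultimately have "(1 - b) * norm (L v) \<le> p + g + C * g + a * (norm z + g)"
      using rel[OF wv(3)] w ab mult_left_mono[of "norm v" "norm z + g" a] by (simp add: algebra_simps)
    also have "\<dots> \<le> (1 + C + a) * (norm z + g + p)"
      using ab C(1) by (simp add: algebra_simps g_def p_def)
    finally have "norm (L v) \<le> (1 + C + a) / (1 - b) * (norm z + g + p)"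
      using ab by (simp add: pos_le_divide_eq mult.commute)
    moreover have "norm (L z) \<le> g + norm (L v)" using Lz w norm_triangle_ineq[of w "L v"] by simp
    moreover have "g \<le> norm z + g + p" by (simp add: p_def)
    ultimately have "norm (L z) \<le> (norm z + g + p) + (1 + C + a) / (1 - b) * (norm z + g + p)"
      by linarith
    then show ?thesis unfolding M_def g_def p_def by (simp only: distrib_right mult_1)
  qed
  then show thesis by (rule that)
qed

text \<open>The estimate on \<open>L\<close> makes \<open>L (z n)\<close> Cauchy, so the closed
  unperturbed node captures the limit point. What remains is to identify the limit of
  \<open>H (z n)\<close>, which closability does on the null sequence
  \<open>z n - l\<close>.\<close>

lemma perturbed_closed: "closed_op (Z, \<lambda>z. (G z, L z + H z, K z))"
  unfolding closed_op_iff_sequentially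
proof (intro allI impI, elim conjE)
  fix z l m assume zZ: "\<forall>n. z n \<in> Z" and zl: "z \<longlonglongrightarrow> l"
    and lim: "(\<lambda>n. (G (z n), L (z n) + H (z n), K (z n))) \<longlonglongrightarrow> m"
  obtain g f k where m: "m = (g, f, k)" by (cases m) auto
  have Gl: "(\<lambda>n. G (z n)) \<longlonglongrightarrow> g" and LHl: "(\<lambda>n. L (z n) + H (z n)) \<longlonglongrightarrow> f"
    and Kl: "(\<lambda>n. K (z n)) \<longlonglongrightarrow> k"
    using tendsto_fst[OF lim] tendsto_fst[OF tendsto_snd[OF lim]] tendsto_snd[OF tendsto_snd[OF lim]]
    by (simp_all add: m)
  obtain M where M: "\<And>z. z \<in> Z \<Longrightarrow> norm (L z) \<le> M * (norm z + norm (G z) + norm (L z + H z))"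
    by (rule L_bounded_by_perturbation) blast
  have est: "dist (L (z i)) (L (z j)) \<le> \<bar>M\<bar> * (dist (z i) (z j) + dist (G (z i)) (G (z j))
      + dist (L (z i) + H (z i)) (L (z j) + H (z j)))" for i j
  proof -
    have "norm (L (z i - z j)) \<le> M * (norm (z i - z j) + norm (G (z i - z j))
        + norm (L (z i - z j) + H (z i - z j)))"
      by (rule M) (use zZ subspace_diff[OF subspace_Z] in auto)
    also have "\<dots> \<le> \<bar>M\<bar> * (norm (z i - z j) + norm (G (z i - z j))
        + norm (L (z i - z j) + H (z i - z j)))" by (intro mult_right_mono) auto
    finally show ?thesis
      using zZ by (simp add: dist_norm real_linear_on_diff[OF G] real_linear_on_diff[OF L]
        real_linear_on_diff[OF H] add_diff_add)
  qed
  have "Cauchy (\<lambda>n. L (z n))"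
  proof (rule metric_CauchyI)
    fix e :: real assume e: "e > 0"
    define d where "d = e / (3 * (\<bar>M\<bar> + 1))"
    have M1: "\<bar>M\<bar> + 1 > 0" by (simp add: add_nonneg_pos)
    then have d: "d > 0" using e by (simp add: d_def)
    obtain N1 where N1: "\<And>i j. i \<ge> N1 \<Longrightarrow> j \<ge> N1 \<Longrightarrow> dist (z i) (z j) < d"
      using metric_CauchyD[OF LIMSEQ_imp_Cauchy[OF zl] d] by blast
    obtain N2 where N2: "\<And>i j. i \<ge> N2 \<Longrightarrow> j \<ge> N2 \<Longrightarrow> dist (G (z i)) (G (z j)) < d"
      using metric_CauchyD[OF LIMSEQ_imp_Cauchy[OF Gl] d] by blast
    obtain N3 where N3: "\<And>i j. i \<ge> N3 \<Longrightarrow> j \<ge> N3 \<Longrightarrow>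
        dist (L (z i) + H (z i)) (L (z j) + H (z j)) < d"
      using metric_CauchyD[OF LIMSEQ_imp_Cauchy[OF LHl] d] by blast
    have "dist (L (z i)) (L (z j)) < e" if ij: "i \<ge> max N1 (max N2 N3)" "j \<ge> max N1 (max N2 N3)" for i j
    proof -
      have "dist (L (z i)) (L (z j)) \<le> \<bar>M\<bar> * (d + d + d)"
        by (rule order_trans[OF est]) (use N1[of i j] N2[of i j] N3[of i j] ij in \<open>auto intro!: mult_left_mono\<close>)
      also have "\<dots> < (\<bar>M\<bar> + 1) * (d + d + d)" using d by (intro mult_strict_right_mono) auto
      also have "\<dots> = d * (3 * (\<bar>M\<bar> + 1))" by (simp add: algebra_simps)
      also have "\<dots> = e" using M1 by (simp add: d_def)
      finally show ?thesis .
    qed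
    then show "\<exists>N. \<forall>i\<ge>N. \<forall>j\<ge>N. dist (L (z i)) (L (z j)) < e" by blast
  qed
  then obtain y where Ll: "(\<lambda>n. L (z n)) \<longlonglongrightarrow> y" using Cauchy_convergent convergent_def by blast
  have "(\<lambda>n. (G (z n), L (z n), K (z n))) \<longlonglongrightarrow> (g, y, k)" by (intro tendsto_Pair Gl Ll Kl)
  from closed_opD[OF node_closed zZ[rule_format] zl this]
  have l: "l \<in> Z" and eqs: "G l = g" "L l = y" "K l = k" by auto
  have "(\<lambda>n. (L (z n) + H (z n)) - L (z n) - H l) \<longlonglongrightarrow> f - y - H l"
    by (intro tendsto_intros LHl Ll)
  then have Hl: "(\<lambda>n. H (z n - l)) \<longlonglongrightarrow> f - y - H l"
    using zZ l by (simp add: real_linear_on_diff[OF H])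
  have "f - y - H l = 0"
    by (rule densely_defined_dissipative_closable[OF H dense_Z H_dissipative _ LIM_zero[OF zl] Hl])
      (use zZ l subspace_diff[OF subspace_Z] in auto)
  then show "l \<in> Z \<and> (G l, L l + H l, K l) = m" using l eqs by (simp add: m algebra_simps)
qed

lemma perturbed_passive: "scattering_passive_node Z G (\<lambda>z. L z + H z) K"
proof (rule scattering_passive_nodeI)
  show "internally_wellposed_node Z G (\<lambda>z. L z + H z) K"
    using wp perturbed_closed generates clinear_on_plus[OF _ H_clinear]
    unfolding internally_wellposed_node_def semigroup_generator_def by blast
  fix z assume z: "z \<in> Z"
  show "2 * inner z (L z + H z) + (norm (K z))\<^sup>2 \<le> (norm (G z))\<^sup>2"
    using scattering_passive_inequality[OF passivity z] H_dissipative z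
    unfolding dissipative_on_def by (fastforce simp: inner_add_right)
qed

end

lemma closed_op_plus_bounded_linear:
  fixes L :: "'a::real_normed_vector \<Rightarrow> 'b::real_normed_vector"
  assumes L: "closed_op (Z, L)" and H: "bounded_linear H"
  shows "closed_op (Z, \<lambda>z. L z + H z)"
  unfolding closed_op_iff_sequentially
proof (intro allI impI, elim conjE)
  fix z l m assume z: "\<forall>n. z n \<in> Z" "z \<longlonglongrightarrow> l" "(\<lambda>n. L (z n) + H (z n)) \<longlonglongrightarrow> m"
  have "(\<lambda>n. (L (z n) + H (z n)) - H (z n)) \<longlonglongrightarrow> m - H l"
    by (intro tendsto_diff z bounded_linear.tendsto[OF H])
  then have "(\<lambda>n. L (z n)) \<longlonglongrightarrow> m - H l" by simp
  from closed_opD[OF L z(1)[rule_format] z(2) this] show "l \<in> Z \<and> L l + H l = m" by simp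
qed

theorem theorem3p2:
  fixes Z domH :: "'x::complex_hilbert set"
    and G :: "'x \<Rightarrow> 'u::complex_hilbert"
    and L H :: "'x \<Rightarrow> 'x"
    and K :: "'x \<Rightarrow> 'y::complex_hilbert"
  assumes node: "scattering_passive_node Z G L K"
    and H_linear: "clinear_on domH H"
    and H_dom: "Z \<subseteq> domH"
    and H_dissipative: "\<forall>z\<in>Z. Re (cinner z (H z)) \<le> 0"
    and i_or_ii:
      "(\<exists>a b. a > 0 \<and> 0 \<le> b \<and> b < 1 \<and>
          (\<forall>z\<in>node_ker Z G. norm (H z) \<le> a * norm z + b * norm (L z))) \<or>
       (\<exists>W ip. hilbert_space_on W ip \<and> node_ker Z G \<subseteq> W \<and> W \<subseteq> domH \<and>
          compact_inclusion (node_ker Z G) (X1_norm L) W (ip_norm ip) \<and>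
          bounded_clinear_on W (ip_norm ip) H)"
  shows "scattering_passive_node Z G (\<lambda>z. L z + H z) K \<and>
    op_dom (semigroup_generator Z G L) = op_dom (semigroup_generator Z G (\<lambda>z. L z + H z)) \<and>
    (strong_node Z G L K \<and> domH = UNIV \<and> bounded_clinear H \<longrightarrow>
      strong_node Z G (\<lambda>z. L z + H z) K)"
proof -
  have wp: "internally_wellposed_node Z G L K"
    using node by (simp add: scattering_passive_node_def)
  have HZ: "clinear_on Z H"
    using wp by (intro clinear_on_subset[OF H_linear _ H_dom])
      (simp add: internally_wellposed_node_def clinear_on_def)
  have diss: "dissipative_on Z H"
    using H_dissipative by (simp add: dissipative_on_def inner_eq_Re_cinner)
  have "\<exists>a b. a > 0 \<and> 0 \<le> b \<and> b < 1 \<and>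
      (\<forall>z\<in>node_ker Z G. norm (H z) \<le> a * norm z + b * norm (L z))"
    using i_or_ii
  proof
    assume "\<exists>W ip. hilbert_space_on W ip \<and> node_ker Z G \<subseteq> W \<and> W \<subseteq> domH \<and>
          compact_inclusion (node_ker Z G) (X1_norm L) W (ip_norm ip) \<and>
          bounded_clinear_on W (ip_norm ip) H"
    then obtain W ip where W: "node_ker Z G \<subseteq> W"
      "compact_inclusion (node_ker Z G) (X1_norm L) W (ip_norm ip)"
      "bounded_clinear_on W (ip_norm ip) H" by blast
    have dense: "closure Z = UNIV"
      using closure_mono[OF node_ker_subset, of Z G] internally_wellposed_nodeD(6)[OF wp] by auto
    \<comment> \<open>The compactness argument gives an arbitrarily small coefficient of
      \<open>norm (L z)\<close>; 1/2 is one choice below one.\<close>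
    obtain a where "a > 0" "\<And>z. z \<in> node_ker Z G \<Longrightarrow> norm (H z) \<le> a * norm z + 1 / 2 * norm (L z)"
      by (rule compact_inclusion_imp_relative_bound[OF clinear_on_imp_real_linear_on[OF HZ] dense diss
          internally_wellposed_nodeD(8)[OF wp] node_ker_subset W, of "1 / 2"]) auto
    then show ?thesis by (intro exI[of _ a] exI[of _ "1 / 2"]) auto
  qed
  then obtain a b where "a > 0" "0 \<le> b" "b < 1"
    "\<And>z. z \<in> node_ker Z G \<Longrightarrow> norm (H z) \<le> a * norm z + b * norm (L z)" by blast
  then interpret perturbed_passive_node Z G L H K a b
    by unfold_locales (use node HZ diss in auto)
  show ?thesis
    \<comment> \<open>The generator domains agree because \<open>node_ker Z G\<close> is determined
      by \<open>Z\<close> and \<open>G\<close> alone.\<close>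
    using perturbed_passive closed_op_plus_bounded_linear[OF _ bounded_clinear_imp_bounded_linear]
    by (auto simp: strong_node_def scattering_passive_node_def semigroup_generator_def op_dom_def)
qed

end
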